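(* Let $\mathbf{A}\in\mathbb{R}^{n\times d}$. Then for each positive integer $k\leq\mathrm{rank}(\mathbf{A})$, there exists a subset $S\subset[d]$ of size $k$ such that $\mathrm{rank}(\mathbf{A}_S)=k$ and \[ \mathrm{maxroot}\ p_{S}(x)\leq \mathrm{maxroot}\ (x^2\cdot\partial_x-d\cdot x)^k \ \det[x\cdot \mathbf{I}_d-\mathbf{A}^{\rm T}\mathbf{A}], \] where $p_S(x)=\det[x\cdot\mathbf{I}_d-\mathbf{A}^{\rm T}(\mathbf{I}_n-\mathbf{A}_S\mathbf{A}_S^\dagger)\mathbf{A}]$.
   Context: $\mathbf{A}_S$ is the submatrix of $\mathbf{A}$ formed by the columns indexed by $S\subset[d]$, and $\mathbf{A}_S^\dagger$ its Moore–Penrose pseudoinverse. $(x^2\partial_x-d\,x)$ is the differential operator $p(x)\mapsto x^2p'(x)-d\,x\,p(x)$, and $(x^2\partial_x-d\,x)^k$ its $k$-fold composition. $\mathrm{maxroot}$ denotes the largest real root. *)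

theory Defs
  imports
    "Jordan_Normal_Form.Char_Poly"
    "Jordan_Normal_Form.DL_Rank"
    "Jordan_Normal_Form.DL_Submatrix"
begin

(* Column (and row) indices are 0-based, as everywhere for the type mat:
   the index set [d] is {0..<d}. *)
definition cols_submat :: "'a mat \<Rightarrow> nat set \<Rightarrow> 'a mat" where
  "cols_submat A S = submatrix A UNIV S"

(* The four Penrose conditions. *)
definition is_pinv :: "real mat \<Rightarrow> real mat \<Rightarrow> bool" where
  "is_pinv A X \<longleftrightarrow>
     X \<in> carrier_mat (dim_col A) (dim_row A) \<and>
     A * X * A = A \<and> X * A * X = X \<and>
     transpose_mat (A * X) = A * X \<and> transpose_mat (X * A) = X * A"

definition pinv :: "real mat \<Rightarrow> real mat" where
  "pinv A = (THE X. is_pinv A X)"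

lemma is_pinv_unique:
  assumes "is_pinv A X" "is_pinv A Y"
  shows "X = Y"
proof -
  define m n where "m = dim_row A" and "n = dim_col A"
  have A: "A \<in> carrier_mat m n" by (simp add: m_def n_def)
  have X: "X \<in> carrier_mat n m" and Y: "Y \<in> carrier_mat n m"
    using assms by (auto simp: is_pinv_def m_def n_def)
  note AX = mult_carrier_mat[OF A X] and AY = mult_carrier_mat[OF A Y]
  note XA = mult_carrier_mat[OF X A] and YA = mult_carrier_mat[OF Y A]
  have x: "A * X * A = A" "X * A * X = X"
      "transpose_mat (A * X) = A * X" "transpose_mat (X * A) = X * A"
    and y: "A * Y * A = A" "Y * A * Y = Y"
      "transpose_mat (A * Y) = A * Y" "transpose_mat (Y * A) = Y * A"
    using assms by (auto simp: is_pinv_def)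
  have "A * Y * (A * X) = A * X"
    using assoc_mult_mat[OF AY A X] y(1) by simp
  hence "transpose_mat (A * Y * (A * X)) = A * X" by (simp add: x(3))
  hence "A * X * (A * Y) = A * X"
    using transpose_mult[OF AY AX] x(3) y(3) by simp
  moreover have "A * X * (A * Y) = A * Y"
    using assoc_mult_mat[OF AX A Y] x(1) by simp
  ultimately have *: "A * X = A * Y" by simp
  have "X * A * (Y * A) = X * A"
    using assoc_mult_mat[OF X A YA] assoc_mult_mat[OF A Y A] y(1) by simp
  hence "transpose_mat (X * A * (Y * A)) = X * A" by (simp add: x(4))
  hence "Y * A * (X * A) = X * A"
    using transpose_mult[OF XA YA] x(4) y(4) by simp
  moreover have "Y * A * (X * A) = Y * A"
    using assoc_mult_mat[OF Y A XA] assoc_mult_mat[OF A X A] x(1) by simp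
  ultimately have **: "X * A = Y * A" by simp
  have "X = X * (A * X)" using x(2) assoc_mult_mat[OF X A X] by simp
  also have "\<dots> = X * A * Y" using * assoc_mult_mat[OF X A Y] by simp
  also have "\<dots> = Y" using ** y(2) by simp
  finally show ?thesis .
qed

lemma pinv_eqI: "is_pinv A X \<Longrightarrow> pinv A = X"
  unfolding pinv_def by (blast intro: is_pinv_unique)

(* The operator x^2 d/dx - d x on polynomials in x. *)
definition polar_op :: "nat \<Rightarrow> real poly \<Rightarrow> real poly" where
  "polar_op d p = [:0, 0, 1:] * pderiv p - [:0, of_nat d:] * p"

(* Meaningful for a nonzero polynomial with at least one real root. *)
definition maxroot :: "real poly \<Rightarrow> real" where
  "maxroot p = Max {x. poly p x = 0}"

end

theory Submission
  imports Defs
begin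

text \<open>The substitution y = -1/x is increasing on x > 0 and carries that half-line onto y < 0,
  so comparing positive roots in x amounts to comparing largest roots in y. Its sign is what gives
  the reversed polynomials of positive semidefinite matrices nonnegative coefficients; neither they
  nor their nonzero derivatives have a root at y >= 0, so no root in x is lost at infinity. The
  obstacle is that the roots of a sum do not in general control those of its summands. What ties
  them together is one comparison polynomial: the sum equals \<open>pderiv g\<close>, and every
  summand \<open>f i\<close> has a nonpositive Wronskian with this same \<open>g\<close>. That
  condition is linear in \<open>f i\<close>, hence it suffices to verify it for the quotients by a
  single linear factor. The order of the derivative counts the columns still to be chosen: before
  comparing, all remaining derivatives are applied to both sides of the one-step identity, so the
  comparisons of successive steps chain by transitivity. The rank hypothesis guarantees that each
  step finds a column with nonzero residual.\<close>

text \<open>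
  Replace det(x I - G) by the reversed polynomial det(I + y G) with y = -1/x; the operator
  \<^const>\<open>polar_op\<close> then becomes plain differentiation. Projecting out one column of A is a
  rank-one Schur downdate of the residual Gram matrix G. With the diagonal entries of G as weights
  (volume sampling) the downdated polynomials add up to the derivative of det(I + y G), and each of
  them is a nonnegative combination of the quotients of det(I + y G) by its linear factors. By
  Laguerre's inequality this gives a Wronskian of constant sign, also after differentiating
  repeatedly, which forces some summand to have its largest root at most that of the sum. Iterating
  k times selects S.
\<close>

section \<open>Real-rooted polynomials and interlacing\<close>

text \<open>Every complex number is a root of 0, so the zero polynomial fails this predicate while
  nonzero constants satisfy it; hence the nonvanishing hypotheses on derivatives below.\<close>

definition real_rooted :: "real poly \<Rightarrow> bool" where
  "real_rooted p \<longleftrightarrow> (\<forall>z. poly (map_poly complex_of_real p) z = 0 \<longrightarrow> Im z = 0)"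

lemma map_poly_of_real_mult:
  "map_poly complex_of_real (p * q) = map_poly complex_of_real p * map_poly complex_of_real q"
  by (rule poly_eqI) (simp add: coeff_map_poly coeff_mult)

lemma map_poly_of_real_add:
  "map_poly complex_of_real (p + q) = map_poly complex_of_real p + map_poly complex_of_real q"
  by (rule poly_eqI) (simp add: coeff_map_poly)

lemma map_poly_of_real_smult:
  "map_poly complex_of_real (Polynomial.smult c p) = Polynomial.smult (of_real c) (map_poly complex_of_real p)"
  by (rule poly_eqI) (simp add: coeff_map_poly)

lemmas map_poly_of_real = map_poly_of_real_mult map_poly_of_real_add map_poly_of_real_smult

lemma poly_map_poly_of_real_linear_prod:
  "poly (map_poly complex_of_real (\<Prod>a\<leftarrow>as. [:- a, 1:])) z = (\<Prod>a\<leftarrow>as. z - of_real a)"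
  by (induction as) (simp_all add: map_poly_of_real del: mult_pCons_left)

lemma real_rooted_split:
  assumes "real_rooted p"
  shows "\<exists>c as. p = Polynomial.smult c (\<Prod>a\<leftarrow>as. [:- a, 1:])"
  using assms
proof (induction "degree p" arbitrary: p)
  case 0
  then obtain c where "p = [:c:]" by (metis degree_eq_zeroE)
  then have "p = Polynomial.smult c (\<Prod>a\<leftarrow>[]. [:- a, 1:])" by simp
  then show ?case by blast
next
  case (Suc n)
  let ?h = "map_poly complex_of_real"
  have "degree (?h p) \<noteq> 0" using Suc.hyps(2) by simp
  then obtain z where z: "poly (?h p) z = 0"
    using fundamental_theorem_of_algebra[of "?h p"] by (metis constant_degree)
  then have "Im z = 0" using Suc.prems by (auto simp: real_rooted_def)
  then obtain a where "z = complex_of_real a" by (metis complex_is_Real_iff Reals_cases)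
  with z have "poly p a = 0" by simp
  then obtain q where q: "p = [:- a, 1:] * q" by (metis poly_eq_0_iff_dvd dvdE)
  with Suc.hyps(2) have "q \<noteq> 0" by auto
  then have "degree q = n" using Suc.hyps(2) q by (simp add: degree_mult_eq del: mult_pCons_left)
  moreover have "real_rooted q"
    using Suc.prems unfolding real_rooted_def q map_poly_of_real by auto
  ultimately obtain c as where "q = Polynomial.smult c (\<Prod>a\<leftarrow>as. [:- a, 1:])"
    using Suc.hyps(1) by metis
  then have "p = Polynomial.smult c (\<Prod>a\<leftarrow>a # as. [:- a, 1:])" using q by simp
  then show ?case by blast
qed

lemma real_rooted_mult: "real_rooted p \<Longrightarrow> real_rooted q \<Longrightarrow> real_rooted (p * q)"
  by (auto simp: real_rooted_def map_poly_of_real)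

text \<open>Off the real axis the imaginary part of p'/p is a sum of terms
  - Im z / |z - a|^2 over the roots a, hence nonzero.\<close>

lemma real_rooted_pderiv:
  assumes "real_rooted p" "pderiv p \<noteq> 0"
  shows "real_rooted (pderiv p)"
proof -
  obtain c as where p: "p = Polynomial.smult c (\<Prod>a\<leftarrow>as. [:- a, 1:])"
    using real_rooted_split assms(1) by blast
  let ?h = "map_poly complex_of_real"
  have c: "c \<noteq> 0" using assms(2) p by auto
  have ne: "as \<noteq> []" using assms(2) p by (auto simp: pderiv_smult)
  have log_deriv: "poly (?h (pderiv (\<Prod>a\<leftarrow>as. [:- a, 1:]))) z
      = (\<Prod>a\<leftarrow>as. z - of_real a) * (\<Sum>a\<leftarrow>as. 1 / (z - of_real a))" if "Im z \<noteq> 0" for z as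
  proof (induction as)
    case Nil
    then show ?case by simp
  next
    case (Cons b bs)
    have "z - of_real b \<noteq> 0" using that by (auto simp: complex_eq_iff)
    then show ?case
      using Cons poly_map_poly_of_real_linear_prod[of bs z]
      by (simp add: pderiv_mult pderiv_pCons map_poly_of_real distrib_left del: mult_pCons_left)
  qed
  show ?thesis
    unfolding real_rooted_def
  proof (intro allI impI, rule ccontr)
    fix z assume root: "poly (?h (pderiv p)) z = 0" and z: "Im z \<noteq> 0"
    have "(\<Prod>a\<leftarrow>as. z - of_real a) \<noteq> 0"
      using z by (force simp: prod_list_zero_iff)
    moreover have "of_real c * ((\<Prod>a\<leftarrow>as. z - of_real a) * (\<Sum>a\<leftarrow>as. 1 / (z - of_real a))) = 0"
      using root log_deriv[OF z, of as] by (simp add: p pderiv_smult map_poly_of_real)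
    ultimately have sum0: "(\<Sum>a\<leftarrow>as. 1 / (z - of_real a)) = 0" using c by simp
    have "Im (\<Sum>a\<leftarrow>as. 1 / (z - of_real a)) = - Im z * (\<Sum>a\<leftarrow>as. 1 / ((Re z - a)^2 + (Im z)^2))"
      by (induction as) (auto simp: Im_divide algebra_simps)
    moreover have "(\<Sum>a\<leftarrow>as. 1 / ((Re z - a)^2 + (Im z)^2)) > 0"
      using ne
    proof (induction as rule: list_nonempty_induct)
      case (single x)
      then show ?case using z by (simp add: sum_power2_gt_zero_iff)
    next
      case (cons x xs)
      have "1 / ((Re z - x)^2 + (Im z)^2) > 0" using z by (simp add: sum_power2_gt_zero_iff)
      with cons show ?case by (simp only: list.map sum_list.Cons add_pos_pos)
    qed
    ultimately show False using z sum0 by simp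
  qed
qed

section \<open>Higher derivatives, Laguerre's inequality and Wronskians\<close>

lemma pderiv_funpow_add:
  "(pderiv ^^ k) (p + q :: 'a :: idom poly) = (pderiv ^^ k) p + (pderiv ^^ k) q"
  by (induction k) (auto simp: pderiv_add)

lemma pderiv_funpow_smult:
  "(pderiv ^^ k) (Polynomial.smult c p :: 'a :: idom poly) = Polynomial.smult c ((pderiv ^^ k) p)"
  by (induction k) (auto simp: pderiv_smult)

lemma pderiv_funpow_sum:
  "(pderiv ^^ k) (\<Sum>i\<in>I. p i :: 'a :: idom poly) = (\<Sum>i\<in>I. (pderiv ^^ k) (p i))"
  by (induction I rule: infinite_finite_induct) (auto simp: pderiv_funpow_add)

lemma real_rooted_pderiv_funpow:
  assumes "real_rooted p" "(pderiv ^^ k) p \<noteq> 0"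
  shows "real_rooted ((pderiv ^^ k) p)"
  using assms(2)
proof (induction k)
  case (Suc k)
  then have "(pderiv ^^ k) p \<noteq> 0" by auto
  with Suc show ?case by (simp add: real_rooted_pderiv)
qed (use assms in auto)

text \<open>Analytically, -(p'/p)' is the sum of 1/(x - a)^2 over the roots. The induction over the
  roots is free of division: passing from q to (x - a) q turns the deficit q'^2 - q q'' into q^2 +
  (x - a)^2 (q'^2 - q q'').\<close>

lemma laguerre_ineq:
  assumes "real_rooted p"
  shows "poly p x * poly (pderiv (pderiv p)) x \<le> (poly (pderiv p) x)\<^sup>2"
proof -
  have lin: "poly p x * poly (pderiv (pderiv p)) x \<le> (poly (pderiv p) x)\<^sup>2"
    if "p = (\<Prod>a\<leftarrow>as. [:- a, 1:])" for p as
    using that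
  proof (induction as arbitrary: p)
    case (Cons a as)
    define q where "q = (\<Prod>a\<leftarrow>as. [:- a, 1:])"
    have p: "p = [:- a, 1:] * q" using Cons.prems by (simp add: q_def)
    have "(poly (pderiv p) x)\<^sup>2 - poly p x * poly (pderiv (pderiv p)) x
        = (poly q x)\<^sup>2 + (x - a)\<^sup>2 * ((poly (pderiv q) x)\<^sup>2 - poly q x * poly (pderiv (pderiv q)) x)"
      unfolding p by (simp add: pderiv_mult pderiv_add pderiv_pCons power2_eq_square del: mult_pCons_left)
        (simp add: algebra_simps)
    moreover have "poly q x * poly (pderiv (pderiv q)) x \<le> (poly (pderiv q) x)\<^sup>2"
      using Cons.IH q_def by blast
    ultimately show ?case by (smt (verit) mult_nonneg_nonneg zero_le_power2)
  qed auto
  obtain c as where p: "p = Polynomial.smult c (\<Prod>a\<leftarrow>as. [:- a, 1:])"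
    using real_rooted_split assms by blast
  show ?thesis
    using mult_left_mono[OF lin[OF refl, of as], of "c\<^sup>2"]
    by (simp add: p pderiv_smult power2_eq_square mult_ac)
qed

text \<open>Leibniz rule, in which only two terms survive because the second derivative of a linear
  factor vanishes.\<close>

lemma pderiv_funpow_linear_mult:
  fixes q :: "real poly"
  shows "(pderiv ^^ Suc t) ([:1, l:] * q)
    = [:1, l:] * (pderiv ^^ Suc t) q + Polynomial.smult (real (Suc t) * l) ((pderiv ^^ t) q)"
proof (induction t)
  case 0
  then show ?case by (simp add: pderiv_mult pderiv_pCons del: mult_pCons_left)
next
  case (Suc t)
  have "pderiv [:1, l:] = [:l:]" by (simp add: pderiv_pCons)
  have "(pderiv ^^ Suc (Suc t)) ([:1, l:] * q)
      = pderiv ([:1, l:] * (pderiv ^^ Suc t) q + Polynomial.smult (real (Suc t) * l) ((pderiv ^^ t) q))"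
    using Suc by simp
  also have "\<dots> = [:1, l:] * (pderiv ^^ Suc (Suc t)) q + Polynomial.smult l ((pderiv ^^ Suc t) q)
      + Polynomial.smult (real (Suc t) * l) ((pderiv ^^ Suc t) q)"
    by (simp add: pderiv_add pderiv_mult pderiv_smult \<open>pderiv [:1, l:] = [:l:]\<close> del: mult_pCons_left)
  also have "\<dots> = [:1, l:] * (pderiv ^^ Suc (Suc t)) q + Polynomial.smult (real (Suc (Suc t)) * l) ((pderiv ^^ Suc t) q)"
    by (simp add: smult_add_left[symmetric] algebra_simps)
  finally show ?case .
qed

text \<open>Sign convention: this is the numerator of the derivative of f/g, so a nonpositive value
  makes f/g nonincreasing wherever g does not vanish.\<close>

definition wronskian :: "real poly \<Rightarrow> real poly \<Rightarrow> real poly" where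
  "wronskian f g = pderiv f * g - f * pderiv g"

text \<open>With u the derivative of q of order t - 1, the two arguments are u' and (1 + l y) u' + t
  l u. The terms containing (1 + l y) cancel and -l (u'^2 + t (u'^2 - u u'')) remains, which
  Laguerre's inequality for u controls.\<close>

lemma wronskian_pderiv_funpow_linear_mult:
  assumes "real_rooted q" "0 \<le> l"
  shows "poly (wronskian ((pderiv ^^ t) q) ((pderiv ^^ t) ([:1, l:] * q))) y \<le> 0"
proof (cases t)
  case 0
  then show ?thesis
    using assms(2) by (simp add: wronskian_def pderiv_mult pderiv_pCons del: mult_pCons_left) (simp add: algebra_simps)
next
  case (Suc s)
  define u where "u = (pderiv ^^ s) q"
  have R: "(pderiv ^^ t) ([:1, l:] * q) = [:1, l:] * pderiv u + Polynomial.smult (real t * l) u"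
    using pderiv_funpow_linear_mult[of s l q] by (simp add: u_def Suc)
  have lag: "poly u y * poly (pderiv (pderiv u)) y \<le> (poly (pderiv u) y)\<^sup>2"
  proof (cases "u = 0")
    case False
    then show ?thesis using laguerre_ineq real_rooted_pderiv_funpow[OF assms(1)] by (simp add: u_def)
  qed simp
  have "poly (wronskian ((pderiv ^^ t) q) ((pderiv ^^ t) ([:1, l:] * q))) y
     = - (l * ((poly (pderiv u) y)\<^sup>2 + real t * ((poly (pderiv u) y)\<^sup>2 - poly u y * poly (pderiv (pderiv u)) y)))"
    unfolding R by (simp add: Suc u_def[symmetric] wronskian_def pderiv_add pderiv_mult pderiv_smult pderiv_pCons
        power2_eq_square del: mult_pCons_left) (simp add: algebra_simps)
  also have "\<dots> \<le> 0"
    using lag assms(2) by simp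
  finally show ?thesis .
qed

section \<open>Comparing largest roots through the sign of the Wronskian\<close>

text \<open>This compares largest roots without naming them: it stays meaningful, and vacuously
  true, when \<open>f\<close> has no real root, as happens once differentiation reaches a
  constant.\<close>

definition roots_below :: "real poly \<Rightarrow> real poly \<Rightarrow> bool" where
  "roots_below f h \<longleftrightarrow> (\<forall>y. poly f y = 0 \<longrightarrow> (\<exists>y'\<ge>y. poly h y' = 0))"

lemma roots_below_refl: "roots_below f f"
  by (auto simp: roots_below_def)

lemma roots_below_trans: "roots_below f g \<Longrightarrow> roots_below g h \<Longrightarrow> roots_below f h"
  unfolding roots_below_def by (meson order_trans)

text \<open>This normalises signs: it survives differentiation and makes a nonzero polynomial
  positive on the positive axis, hence positive to the right of its largest real root.\<close>

definition nonneg_coeffs :: "real poly \<Rightarrow> bool" where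
  "nonneg_coeffs p \<longleftrightarrow> (\<forall>i. 0 \<le> coeff p i)"

lemma nonneg_coeffs_pderiv: "nonneg_coeffs p \<Longrightarrow> nonneg_coeffs (pderiv p)"
  by (auto simp: nonneg_coeffs_def coeff_pderiv)

lemma nonneg_coeffs_pderiv_funpow: "nonneg_coeffs p \<Longrightarrow> nonneg_coeffs ((pderiv ^^ k) p)"
  by (induction k) (auto intro: nonneg_coeffs_pderiv)

lemma nonneg_coeffs_poly_pos:
  assumes "nonneg_coeffs p" "p \<noteq> 0" "0 < y"
  shows "0 < poly p y"
proof -
  have "0 < coeff p (degree p) * y ^ degree p"
    using assms by (intro mult_pos_pos zero_less_power) (auto simp: nonneg_coeffs_def less_le)
  also have "\<dots> \<le> (\<Sum>i\<le>degree p. coeff p i * y ^ i)"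
    by (rule member_le_sum) (use assms in \<open>auto simp: nonneg_coeffs_def\<close>)
  finally show ?thesis by (simp add: poly_altdef)
qed

text \<open>The value at \<open>max y 0 + 1\<close> is positive, so a negative value at
  \<open>y\<close> would force a root to the right of \<open>a\<close>.\<close>

lemma poly_no_roots_above_pos:
  assumes "nonneg_coeffs p" "p \<noteq> 0" "\<And>x. a < x \<Longrightarrow> poly p x \<noteq> 0" "a < y"
  shows "0 < poly p y"
proof (rule ccontr)
  assume "\<not> 0 < poly p y"
  then have neg: "poly p y < 0" using assms(3,4) by (metis linorder_neqE_linordered_idom)
  define b where "b = max y 0 + 1"
  have "y < b" "0 < b" by (auto simp: b_def)
  then obtain x where "y < x" "x < b" "poly p x = 0"
    using poly_IVT_pos[of y b p] neg nonneg_coeffs_poly_pos[OF assms(1,2)] by blast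
  with assms(3,4) show False by force
qed

lemma wronskian_quotient_antimono:
  assumes W: "\<And>y. poly (wronskian f g) y \<le> 0"
    and "a \<le> b" and ne: "\<And>x. a \<le> x \<Longrightarrow> x \<le> b \<Longrightarrow> poly g x \<noteq> 0"
  shows "poly f b / poly g b \<le> poly f a / poly g a"
proof (rule DERIV_nonpos_imp_nonincreasing[where f = "\<lambda>x. poly f x / poly g x", OF assms(2)])
  fix x assume "a \<le> x" "x \<le> b"
  with ne have "poly g x \<noteq> 0" by blast
  then have "((\<lambda>x. poly f x / poly g x) has_real_derivative
      (poly (pderiv f) x * poly g x - poly f x * poly (pderiv g) x) / (poly g x * poly g x)) (at x)"
    by (intro DERIV_divide poly_DERIV)
  moreover have "(poly (pderiv f) x * poly g x - poly f x * poly (pderiv g) x) / (poly g x * poly g x) \<le> 0"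
    using W[of x] by (intro divide_nonpos_nonneg) (auto simp: wronskian_def)
  ultimately show "\<exists>y. ((\<lambda>x. poly f x / poly g x) has_real_derivative y) (at x) \<and> y \<le> 0" by blast
qed

text \<open>Suppose the largest root z of f exceeds \<open>\<theta>\<close>. Then g increases
  strictly from \<open>\<theta>\<close> on, and f/g is nonincreasing where g has no zero. If g(z) >
  0, then f/g would be 0 at z and positive at z + 1. If g(z) < 0, then f/g is at most 0 at
  \<open>\<theta>\<close> and equal to 0 at z, hence 0 in between, giving infinitely many roots. If
  g(z) = 0, the common factor is cancelled, and monotonicity of the quotient makes f negative at
  \<open>\<theta>\<close>.\<close>

lemma roots_below_of_wronskian:
  assumes W: "\<And>y. poly (wronskian f g) y \<le> 0"
    and f: "nonneg_coeffs f" "f \<noteq> 0"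
    and g': "nonneg_coeffs (pderiv g)" "pderiv g \<noteq> 0"
    and \<theta>: "\<And>y. \<theta> < y \<Longrightarrow> poly (pderiv g) y \<noteq> 0"
    and f\<theta>: "0 \<le> poly f \<theta>"
  shows "poly f y = 0 \<Longrightarrow> y \<le> \<theta>"
proof (rule ccontr)
  assume "poly f y = 0" "\<not> y \<le> \<theta>"
  define Z where "Z = {x. poly f x = 0}"
  have Z: "finite Z" "y \<in> Z" using poly_roots_finite[OF f(2)] \<open>poly f y = 0\<close> by (auto simp: Z_def)
  define z where "z = Max Z"
  have "z \<in> Z" and z_max: "\<And>x. x \<in> Z \<Longrightarrow> x \<le> z"
    using Max_in[of Z] Max_ge[of Z] Z unfolding z_def by blast+
  then have z: "poly f z = 0" "\<theta> < z"
    using Z(2) \<open>\<not> y \<le> \<theta>\<close> by (force simp: Z_def)+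
  have z_no_roots: "poly f x \<noteq> 0" if "z < x" for x
    using z_max[of x] that by (auto simp: Z_def)
  have f_pos: "0 < poly f x" if "z < x" for x
    using poly_no_roots_above_pos[OF f z_no_roots that] by blast
  have g'_pos: "0 < poly (pderiv g) x" if "\<theta> < x" for x
    using poly_no_roots_above_pos[OF g' \<theta> that] by blast
  have g_less: "poly g a < poly g b" if "\<theta> \<le> a" "a < b" for a b
  proof (rule DERIV_pos_imp_increasing_open[where f = "poly g", OF that(2)])
    fix x assume "a < x" "x < b"
    then show "\<exists>y. (poly g has_real_derivative y) (at x) \<and> y > 0"
      using poly_DERIV[of g x] g'_pos[of x] that(1) by (intro exI[of _ "poly (pderiv g) x"]) auto
  qed (auto intro: continuous_at_imp_continuous_on)
  note quot = wronskian_quotient_antimono[OF W]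
  consider "poly g z > 0" | "poly g z < 0" | "poly g z = 0" by linarith
  then show False
  proof cases
    case 1
    have pos: "poly g x > 0" if "z \<le> x" for x
      using g_less[of z x] 1 z(2) that by (cases "x = z") auto
    have "poly f (z + 1) / poly g (z + 1) \<le> poly f z / poly g z"
      by (rule quot) (use pos in force)+
    moreover have "poly g (z + 1) > 0" by (rule pos) simp
    ultimately show False using z(1) f_pos[of "z + 1"] by (auto simp: divide_le_0_iff)
  next
    case 2
    have neg: "poly g x < 0" if "\<theta> \<le> x" "x \<le> z" for x
      using g_less[of x z] 2 that by (cases "x = z") auto
    have "poly f x = 0" if x: "\<theta> < x" "x < z" for x
    proof -
      have ne: "poly g v \<noteq> 0" if "\<theta> \<le> v" "v \<le> z" for v using neg[OF that] by simp
      have "poly f x / poly g x \<le> poly f \<theta> / poly g \<theta>" "poly f z / poly g z \<le> poly f x / poly g x"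
        by (rule quot; use x ne in force)+
      moreover have "poly f \<theta> / poly g \<theta> \<le> 0" using neg[of \<theta>] f\<theta> z(2) by (simp add: divide_nonneg_neg)
      moreover have "poly f z / poly g z = 0" using z(1) by simp
      ultimately have "poly f x / poly g x = 0" by linarith
      then show "poly f x = 0" using ne[of x] x by simp
    qed
    then have "{\<theta><..<z} \<subseteq> Z" by (auto simp: Z_def)
    then show False using Z(1) infinite_Ioo[OF z(2)] finite_subset by blast
  next
    case 3
    obtain f1 where f1: "f = [:- z, 1:] * f1"
      using z(1) unfolding poly_eq_0_iff_dvd by (rule dvdE)
    obtain g1 where g1: "g = [:- z, 1:] * g1"
      using 3 unfolding poly_eq_0_iff_dvd by (rule dvdE)
    \<comment> \<open>At z the cofactor equals the derivative of g; elsewhere g and x - z have the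
      same sign because g is increasing through its zero z.\<close>
    have g1_pos: "poly g1 x > 0" if "\<theta> \<le> x" for x
    proof -
      have "poly (pderiv g) z = poly g1 z"
        unfolding g1 by (simp add: pderiv_mult pderiv_pCons del: mult_pCons_left)
      then have "x = z \<Longrightarrow> ?thesis" using g'_pos[OF z(2)] by simp
      moreover have "x < z \<Longrightarrow> ?thesis" using g_less[of x z] that 3
        by (simp add: g1 zero_less_mult_iff mult_less_0_iff del: mult_pCons_left)
      moreover have "x > z \<Longrightarrow> ?thesis" using g_less[of z x] z(2) 3
        by (simp add: g1 zero_less_mult_iff del: mult_pCons_left)
      ultimately show ?thesis by linarith
    qed
    \<comment> \<open>Cancelling x - z divides the Wronskian by (x - z)^2, which keeps its sign off
      z; continuity extends the sign to z itself.\<close>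
    have W1: "poly (wronskian f1 g1) x \<le> 0" for x
    proof (rule ccontr)
      assume "\<not> poly (wronskian f1 g1) x \<le> 0"
      then have pos: "0 < poly (wronskian f1 g1) x" by simp
      have "poly (wronskian f g) v = (v - z)\<^sup>2 * poly (wronskian f1 g1) v" for v
        unfolding f1 g1 wronskian_def
        by (simp add: pderiv_mult pderiv_pCons del: mult_pCons_left) (simp add: algebra_simps power2_eq_square)
      then have nonpos: "poly (wronskian f1 g1) v \<le> 0" if "v \<noteq> z" for v
        using W[of v] that by (simp add: mult_le_0_iff)
      then have "x = z" using pos by force
      have "eventually (\<lambda>v. poly (wronskian f1 g1) v > 0) (at z)"
        using order_tendstoD(1)[OF poly_isCont[of z "wronskian f1 g1", unfolded isCont_def]] pos \<open>x = z\<close>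
        by blast
      moreover have "eventually (\<lambda>v. v \<noteq> z) (at z)" by (simp add: eventually_at_filter)
      ultimately have "eventually (\<lambda>v. False) (at z)"
        by eventually_elim (use nonpos in force)
      then show False by simp
    qed
    have "poly f1 (z + 1) / poly g1 (z + 1) \<le> poly f1 \<theta> / poly g1 \<theta>"
      using z(2) g1_pos by (intro wronskian_quotient_antimono[OF W1]) force+
    moreover have "poly f1 (z + 1) > 0" using f_pos[of "z + 1"] by (simp add: f1 del: mult_pCons_left)
    ultimately have "poly f1 \<theta> > 0"
      using g1_pos[of \<theta>] g1_pos[of "z + 1"] z(2)
      by (smt (verit) divide_nonpos_pos divide_pos_pos)
    then have "poly f \<theta> < 0" using z(2) by (simp add: f1 mult_less_0_iff del: mult_pCons_left)
    with f\<theta> show False by simp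
  qed
qed

text \<open>One step of the interlacing-families argument; the polynomial \<^term>\<open>g\<close> plays the role of
  the common interlacer.\<close>

lemma exists_roots_below:
  assumes fin: "finite I" and sum: "pderiv g = (\<Sum>i\<in>I. Polynomial.smult (w i) (f i))"
    and w: "\<And>i. i \<in> I \<Longrightarrow> 0 < w i"
    and W: "\<And>i y. i \<in> I \<Longrightarrow> poly (wronskian (f i) g) y \<le> 0"
    and f: "\<And>i. i \<in> I \<Longrightarrow> nonneg_coeffs (f i)" "\<And>i. i \<in> I \<Longrightarrow> f i \<noteq> 0"
    and g': "real_rooted (pderiv g)" "pderiv g \<noteq> 0"
  shows "\<exists>i\<in>I. roots_below (f i) (pderiv g)"
proof (cases "degree (pderiv g) = 0")
  \<comment> \<open>A constant sum has no largest root to compare with. Nonnegative coefficients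
    with positive weights cannot cancel, so each summand is a nonzero constant and the comparison
    holds vacuously.\<close>
  case True
  obtain i where i: "i \<in> I" using sum g'(2) by fastforce
  have "coeff (f i) n = 0" if "n > 0" for n
  proof -
    have "(\<Sum>j\<in>I. w j * coeff (f j) n) = 0"
      using arg_cong[OF sum, of "\<lambda>p. coeff p n"] True that by (simp add: coeff_sum coeff_eq_0)
    moreover have "0 \<le> w j * coeff (f j) n" if "j \<in> I" for j
      using w[OF that] f(1)[OF that] by (simp add: nonneg_coeffs_def)
    ultimately have "w i * coeff (f i) n = 0"
      using fin i by (simp add: sum_nonneg_eq_0_iff)
    then show ?thesis using w[OF i] by simp
  qed
  then have "degree (f i) = 0" by (metis leading_coeff_0_iff degree_0 gr0I)
  then obtain c where "f i = [:c:]" by (metis degree_eq_zeroE)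
  then have "roots_below (f i) (pderiv g)" using f(2)[OF i] by (simp add: roots_below_def)
  with i show ?thesis by blast
next
  case False
  \<comment> \<open>Real-rootedness guarantees that the nonconstant \<open>pderiv g\<close> has a
    real root, so that a largest one, \<open>\<theta>\<close>, exists.\<close>
  obtain c as where g'_eq: "pderiv g = Polynomial.smult c (\<Prod>a\<leftarrow>as. [:- a, 1:])"
    using real_rooted_split g'(1) by blast
  obtain b bs where "as = b # bs" using g'_eq False by (cases as) auto
  then have "poly (pderiv g) b = 0" by (simp add: g'_eq del: mult_pCons_left)
  define Z where "Z = {x. poly (pderiv g) x = 0}"
  have Z: "finite Z" "b \<in> Z" using poly_roots_finite[OF g'(2)] \<open>poly (pderiv g) b = 0\<close> by (auto simp: Z_def)
  define \<theta> where "\<theta> = Max Z"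
  have "\<theta> \<in> Z" and \<theta>_max: "\<And>x. x \<in> Z \<Longrightarrow> x \<le> \<theta>"
    using Max_in[of Z] Max_ge[of Z] Z unfolding \<theta>_def by blast+
  then have \<theta>: "poly (pderiv g) \<theta> = 0" by (simp add: Z_def)
  have \<theta>_no_roots: "poly (pderiv g) x \<noteq> 0" if "\<theta> < x" for x
    using \<theta>_max[of x] that by (auto simp: Z_def)
  have nonneg: "nonneg_coeffs (pderiv g)"
    unfolding sum nonneg_coeffs_def coeff_sum coeff_smult
    using w f(1) by (intro allI sum_nonneg mult_nonneg_nonneg) (auto simp: nonneg_coeffs_def order_less_imp_le)
  \<comment> \<open>The weighted values at \<open>\<theta>\<close> sum to 0 and so cannot all be
    negative. This is the only place where the choice of the index is made.\<close>
  have "\<exists>i\<in>I. 0 \<le> poly (f i) \<theta>"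
  proof (rule ccontr)
    assume "\<not> ?thesis"
    then have neg: "w i * poly (f i) \<theta> < 0" if "i \<in> I" for i
      using w[OF that] that by (auto simp: mult_less_0_iff)
    have "I \<noteq> {}" using sum g'(2) by auto
    then have "(\<Sum>i\<in>I. w i * poly (f i) \<theta>) < 0"
      using sum_strict_mono[OF fin, of "\<lambda>i. w i * poly (f i) \<theta>" "\<lambda>_. 0"] neg by simp
    then show False using \<theta> by (simp add: sum poly_sum)
  qed
  then obtain i where i: "i \<in> I" "0 \<le> poly (f i) \<theta>" by blast
  have "roots_below (f i) (pderiv g)"
    unfolding roots_below_def
    using roots_below_of_wronskian[OF W[OF i(1)] f(1)[OF i(1)] f(2)[OF i(1)] nonneg g'(2) \<theta>_no_roots i(2)] \<theta>
    by blast
  with i(1) show ?thesis by blast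
qed

section \<open>The spectral theorem for real symmetric matrices\<close>

text \<open>For an eigenvector v the Hermitian form \<open>s\<close> equals z times the squared norm
  of v, and conjugating it only exchanges the summation indices, so it is real.\<close>

lemma symmetric_mat_eigenvalue_real:
  fixes G :: "real mat"
  assumes G: "G \<in> carrier_mat d d" and sym: "transpose_mat G = G"
    and ev: "eigenvalue (map_mat complex_of_real G) z"
  shows "Im z = 0"
proof -
  let ?C = "map_mat complex_of_real G"
  obtain v where v: "v \<in> carrier_vec d" "v \<noteq> 0\<^sub>v d" "?C *\<^sub>v v = z \<cdot>\<^sub>v v"
    using ev G by (auto simp: eigenvalue_def eigenvector_def)
  have Gv: "(\<Sum>j<d. of_real (G $$ (i, j)) * v $ j) = z * v $ i" if "i < d" for i
  proof -
    have "(?C *\<^sub>v v) $ i = (\<Sum>j<d. of_real (G $$ (i, j)) * v $ j)"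
      using that G v(1) by (auto simp: scalar_prod_def lessThan_atLeast0 intro!: sum.cong)
    then show ?thesis using that v by simp
  qed
  define s where "s = (\<Sum>i<d. \<Sum>j<d. of_real (G $$ (i, j)) * cnj (v $ i) * v $ j)"
  define N where "N = (\<Sum>i<d. (cmod (v $ i))\<^sup>2)"
  have "s = (\<Sum>i<d. cnj (v $ i) * (\<Sum>j<d. of_real (G $$ (i, j)) * v $ j))"
    by (simp add: s_def sum_distrib_left mult_ac)
  also have "\<dots> = (\<Sum>i<d. z * (cnj (v $ i) * v $ i))"
    using Gv by (intro sum.cong) (auto simp: mult_ac)
  also have "\<dots> = z * of_real N"
    by (simp add: N_def sum_distrib_left complex_norm_square[symmetric] mult.commute)
  finally have "s = z * of_real N" .
  have "G $$ (i, j) = G $$ (j, i)" if "i < d" "j < d" for i j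
    using that G arg_cong[OF sym, of "\<lambda>M. M $$ (j, i)"] by simp
  then have "cnj s = (\<Sum>i<d. \<Sum>j<d. of_real (G $$ (j, i)) * cnj (v $ j) * v $ i)"
    unfolding s_def cnj_sum by (intro sum.cong) auto
  also have "\<dots> = s" unfolding s_def by (rule sum.swap)
  finally have "Im s = 0" by (simp add: complex_eq_iff)
  have "N \<noteq> 0"
  proof
    assume "N = 0"
    then have "\<forall>i<d. v $ i = 0" by (auto simp: N_def sum_nonneg_eq_0_iff)
    then show False using v(1,2) by (metis eq_vecI carrier_vecD index_zero_vec)
  qed
  then show ?thesis using \<open>Im s = 0\<close> \<open>s = z * of_real N\<close> by simp
qed

text \<open>The complex characteristic polynomial has a root, which is real by symmetry and
  therefore also an eigenvalue over the reals; a real eigenvector is then normalised.\<close>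

lemma symmetric_mat_unit_eigenvector:
  fixes G :: "real mat"
  assumes G: "G \<in> carrier_mat d d" and sym: "transpose_mat G = G" and d: "0 < d"
  obtains l v where "v \<in> carrier_vec d" "v \<bullet> v = 1" "G *\<^sub>v v = l \<cdot>\<^sub>v v"
proof -
  let ?C = "map_mat complex_of_real G"
  have C: "?C \<in> carrier_mat d d" using G by simp
  have "degree (char_poly ?C) = d" using degree_monic_char_poly[OF C] by simp
  then obtain z where z: "poly (char_poly ?C) z = 0"
    using fundamental_theorem_of_algebra[of "char_poly ?C"] d by (metis constant_degree less_numeral_extra(3))
  then have "Im z = 0"
    using symmetric_mat_eigenvalue_real[OF G sym] eigenvalue_root_char_poly[OF C] by blast
  then have "z = of_real (Re z)" by (simp add: complex_eq_iff)
  then have "poly (map_poly complex_of_real (char_poly G)) (of_real (Re z)) = 0"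
    using z of_real_hom.char_poly_hom[OF G] by metis
  then have "poly (char_poly G) (Re z) = 0" by simp
  then obtain u where u: "u \<in> carrier_vec d" "u \<noteq> 0\<^sub>v d" "G *\<^sub>v u = Re z \<cdot>\<^sub>v u"
    using eigenvalue_root_char_poly[OF G] G by (auto simp: eigenvalue_def eigenvector_def)
  define a where "a = 1 / sqrt (u \<bullet> u)"
  have pos: "u \<bullet> u > 0"
    using conjugate_square_greater_0_vec[OF u(1)] u(2) by simp
  have "(a \<cdot>\<^sub>v u) \<bullet> (a \<cdot>\<^sub>v u) = a * a * (u \<bullet> u)"
    using u(1) by (simp add: mult.assoc)
  also have "\<dots> = 1" using pos by (simp add: a_def)
  finally have "(a \<cdot>\<^sub>v u) \<bullet> (a \<cdot>\<^sub>v u) = 1" .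
  moreover have "G *\<^sub>v (a \<cdot>\<^sub>v u) = Re z \<cdot>\<^sub>v (a \<cdot>\<^sub>v u)"
    using G u by (simp add: mult_mat_vec smult_smult_assoc mult.commute)
  ultimately show ?thesis using that u(1) by (meson smult_carrier_vec)
qed

text \<open>The reflection I - 2 u u^T / |u|^2 with u = v - e_0 exchanges v and e_0. Being symmetric
  and its own inverse, it completes v to an orthonormal basis in closed form; for v = e_0 the vector
  u vanishes and the identity serves.\<close>

lemma householder:
  fixes v :: "real vec"
  assumes v: "v \<in> carrier_vec n" "v \<bullet> v = 1" and n: "0 < n"
  obtains H where "H \<in> carrier_mat n n" "transpose_mat H = H" "H * H = 1\<^sub>m n" "col H 0 = v"
proof (cases "v = unit_vec n 0")
  case True
  then show ?thesis using that[of "1\<^sub>m n"] n by simp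
next
  case False
  define u where "u = (\<lambda>i. v $ i - (if i = 0 then 1 else 0 :: real))"
  define S where "S = (\<Sum>i<n. u i * u i)"
  define H where "H = mat n n (\<lambda>(i, j). (if i = j then 1 else 0) - 2 / S * (u i * u j))"
  have vv: "(\<Sum>i<n. v $ i * v $ i) = 1"
    using v by (simp add: scalar_prod_def lessThan_atLeast0)
  have "S = (\<Sum>i<n. v $ i * v $ i - 2 * (if i = 0 then v $ i else 0) + (if i = 0 then 1 else 0))"
    unfolding S_def u_def by (intro sum.cong) (auto simp: algebra_simps)
  also have "\<dots> = 2 - 2 * v $ 0"
    using n by (simp add: sum.distrib sum_subtractf sum_distrib_left[symmetric] sum.delta' vv)
  finally have S: "S = 2 - 2 * v $ 0" .
  have "S \<noteq> 0"
  proof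
    assume "S = 0"
    then have "\<forall>i<n. u i = 0" by (auto simp: S_def sum_nonneg_eq_0_iff)
    then have "v = unit_vec n 0" using v by (intro eq_vecI) (auto simp: u_def)
    with False show False ..
  qed
  have carr: "H \<in> carrier_mat n n" by (simp add: H_def)
  moreover have "transpose_mat H = H" by (rule eq_matI) (auto simp: H_def)
  moreover have "H * H = 1\<^sub>m n"
  proof (rule eq_matI)
    fix i j assume "i < dim_row (1\<^sub>m n)" "j < dim_col (1\<^sub>m n)"
    then have ij: "i < n" "j < n" by auto
    define c where "c = 4 / (S * S) * (u i * u j)"
    have "(H * H) $$ (i, j) = (\<Sum>k<n. ((if i = k then 1 else 0) - 2 / S * (u i * u k))
        * ((if k = j then 1 else 0) - 2 / S * (u k * u j)))"
      using ij by (simp add: H_def scalar_prod_def lessThan_atLeast0)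
    also have "\<dots> = (\<Sum>k<n. (if k = i then (if i = j then 1 else 0) else 0)
        - (if k = i then 2 / S * (u i * u j) else 0) - (if k = j then 2 / S * (u i * u j) else 0)
        + c * (u k * u k))"
      unfolding c_def by (intro sum.cong) (auto simp: algebra_simps)
    also have "\<dots> = (if i = j then 1 else 0) - 4 / S * (u i * u j) + c * S"
      using ij by (simp add: sum.distrib sum_subtractf sum_distrib_left[symmetric] S_def)
    also have "\<dots> = (if i = j then 1 else 0)" using \<open>S \<noteq> 0\<close> by (simp add: c_def)
    finally show "(H * H) $$ (i, j) = 1\<^sub>m n $$ (i, j)" using ij by simp
  qed (simp_all add: H_def)
  moreover have "col H 0 = v"
  proof (rule eq_vecI)
    fix i assume "i < dim_vec v"
    then have i: "i < n" using v by simp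
    \<comment> \<open>Here \<open>u 0\<close> is \<open>v $ 0 - 1\<close>, which is
      \<open>- S / 2\<close> by the formula for \<open>S\<close>.\<close>
    have "2 / S * u 0 = -1" using \<open>S \<noteq> 0\<close> by (simp add: S u_def field_simps)
    then have "2 / S * (u i * u 0) = - u i" by (metis mult.assoc mult.commute mult_minus1)
    then show "col H 0 $ i = v $ i" using i n by (simp add: H_def) (simp add: u_def)
  qed (use v in \<open>simp add: H_def\<close>)
  ultimately show ?thesis by (rule that)
qed

text \<open>Deflation: a Householder reflection with a unit eigenvector as first column conjugates G
  to a matrix whose first column is l e_0. By symmetry so is its first row, and the induction
  hypothesis diagonalises the remaining block.\<close>

theorem real_spectral_theorem:
  fixes G :: "real mat"
  assumes "G \<in> carrier_mat d d" "transpose_mat G = G"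
  shows "\<exists>U D. U \<in> carrier_mat d d \<and> D \<in> carrier_mat d d \<and> diagonal_mat D \<and>
    transpose_mat U * U = 1\<^sub>m d \<and> G = U * D * transpose_mat U"
  using assms
proof (induction d arbitrary: G)
  case 0
  then have "diagonal_mat G" "transpose_mat (1\<^sub>m 0) * 1\<^sub>m 0 = 1\<^sub>m 0" "G = 1\<^sub>m 0 * G * transpose_mat (1\<^sub>m 0)"
    by (auto simp: diagonal_mat_def)
  with 0 show ?case by (metis one_carrier_mat)
next
  case (Suc d)
  note G = Suc.prems(1)
  obtain l v where v: "v \<in> carrier_vec (Suc d)" "v \<bullet> v = 1" "G *\<^sub>v v = l \<cdot>\<^sub>v v"
    using symmetric_mat_unit_eigenvector[OF Suc.prems] by blast
  obtain H where H: "H \<in> carrier_mat (Suc d) (Suc d)" "transpose_mat H = H" "H * H = 1\<^sub>m (Suc d)" "col H 0 = v"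
    using householder[OF v(1,2)] by blast
  define M where "M = H * G * H"
  have M: "M \<in> carrier_mat (Suc d) (Suc d)" using H G by (simp add: M_def)
  have symM: "transpose_mat M = M"
    using G H Suc.prems(2) by (simp add: M_def transpose_mult[of _ "Suc d" "Suc d" _ "Suc d"] assoc_mult_mat[of _ "Suc d" "Suc d" _ "Suc d" _ "Suc d"])
  have "col M 0 = (H * G) *\<^sub>v col H 0"
    unfolding M_def using H G by (subst col_mult2[of _ "Suc d" "Suc d" _ "Suc d"]) (auto simp del: col_mult)
  also have "\<dots> = H *\<^sub>v (l \<cdot>\<^sub>v v)" using H G v by (simp add: assoc_mult_mat_vec[of _ "Suc d" "Suc d" _ "Suc d"])
  also have "\<dots> = l \<cdot>\<^sub>v (H *\<^sub>v v)" using H v by (simp add: mult_mat_vec)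
  also have "H *\<^sub>v v = col (H * H) 0" using H(1,4) by (simp add: col_mult2[of _ "Suc d" "Suc d" _ "Suc d"] del: col_mult)
  also have "\<dots> = unit_vec (Suc d) 0" by (simp add: H(3))
  finally have col0: "M $$ (i, 0) = (if i = 0 then l else 0)" if "i < Suc d" for i
    using that M by (metis (no_types, lifting) col_def index_col carrier_matD index_smult_vec(1)
        index_unit_vec(1,3) mult.right_neutral mult_zero_right zero_less_Suc)
  have row0: "M $$ (0, i) = (if i = 0 then l else 0)" if "i < Suc d" for i
    using that M col0[OF that] arg_cong[OF symM, of "\<lambda>N. N $$ (i, 0)"] by simp
  define L where "L = mat 1 1 (\<lambda>_. l)"
  define M' where "M' = mat d d (\<lambda>(i, j). M $$ (Suc i, Suc j))"
  have L: "L \<in> carrier_mat 1 1" "transpose_mat L = L" by (auto simp: L_def)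
  have M': "M' \<in> carrier_mat d d" by (simp add: M'_def)
  have blockM: "M = four_block_mat L (0\<^sub>m 1 d) (0\<^sub>m d 1) M'"
    using M by (intro eq_matI) (auto simp: L_def M'_def col0 row0)
  have "transpose_mat M' = M'"
  proof (rule eq_matI)
    fix i j assume "i < dim_row M'" "j < dim_col M'"
    then show "transpose_mat M' $$ (i, j) = M' $$ (i, j)"
      using M arg_cong[OF symM, of "\<lambda>N. N $$ (Suc i, Suc j)"] by (simp add: M'_def)
  qed (simp_all add: M'_def)
  then obtain U' D' where U': "U' \<in> carrier_mat d d" "D' \<in> carrier_mat d d" "diagonal_mat D'"
      "transpose_mat U' * U' = 1\<^sub>m d" "M' = U' * D' * transpose_mat U'"
    using Suc.IH[OF M'] by blast
  define V where "V = four_block_mat (1\<^sub>m 1) (0\<^sub>m 1 d) (0\<^sub>m d 1) U'"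
  define D where "D = four_block_mat L (0\<^sub>m 1 d) (0\<^sub>m d 1) D'"
  have V: "V \<in> carrier_mat (Suc d) (Suc d)" using four_block_carrier_mat[OF one_carrier_mat[of 1] U'(1)] by (simp add: V_def)
  have D: "D \<in> carrier_mat (Suc d) (Suc d)" using four_block_carrier_mat[OF L(1) U'(2)] by (simp add: D_def)
  have Vt: "transpose_mat V = four_block_mat (1\<^sub>m 1) (0\<^sub>m 1 d) (0\<^sub>m d 1) (transpose_mat U')"
    unfolding V_def using U' by (subst transpose_four_block_mat[of _ 1 1 _ d _ d]) auto
  have "diagonal_mat D"
    using U'(2,3) L(1) by (auto simp: diagonal_mat_def D_def)
  have one: "four_block_mat (1\<^sub>m 1) (0\<^sub>m 1 d) (0\<^sub>m d 1) (1\<^sub>m d) = (1\<^sub>m (Suc d) :: real mat)"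
    by (rule eq_matI) auto
  have VtV: "transpose_mat V * V = 1\<^sub>m (Suc d)"
    unfolding Vt unfolding V_def using U'
    by (subst mult_four_block_mat[of _ 1 1 _ d _ d _ _ 1 _ d]) (auto simp: one)
  have VDV: "V * D * transpose_mat V = M"
    unfolding Vt unfolding V_def D_def blockM using U' L
    by (subst mult_four_block_mat[of _ 1 1 _ d _ d _ _ 1 _ d], auto)
       (subst mult_four_block_mat[of _ 1 1 _ d _ d _ _ 1 _ d], auto)
  have HMH: "H * M * H = G"
  proof -
    have "H * M * H = H * (H * G * H) * H" by (simp add: M_def)
    also have "\<dots> = (H * H) * G * (H * H)"
      using G H(1) by (simp add: assoc_mult_mat[of _ "Suc d" "Suc d" _ "Suc d" _ "Suc d"])
    finally show ?thesis using G by (simp add: H(3))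
  qed
  define U where "U = H * V"
  have U: "U \<in> carrier_mat (Suc d) (Suc d)" using H V by (simp add: U_def)
  have Ut: "transpose_mat U = transpose_mat V * H"
    using H V by (simp add: U_def transpose_mult[of _ "Suc d" "Suc d" _ "Suc d"])
  have "transpose_mat U * U = transpose_mat V * (H * H) * V"
    unfolding Ut unfolding U_def using H(1) V by (simp add: assoc_mult_mat[of _ "Suc d" "Suc d" _ "Suc d" _ "Suc d"])
  then have "transpose_mat U * U = 1\<^sub>m (Suc d)" using V VtV by (simp add: H(3))
  moreover have "U * D * transpose_mat U = H * (V * D * transpose_mat V) * H"
    unfolding Ut unfolding U_def using H(1) V D by (simp add: assoc_mult_mat[of _ "Suc d" "Suc d" _ "Suc d" _ "Suc d"])
  ultimately show ?case using U D \<open>diagonal_mat D\<close> by (metis VDV HMH)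
qed

text \<open>Matrix determinant lemma. The bordered matrix \<open>N\<close> with blocks diag(a), -u,
  w, 1 is evaluated by two block eliminations; the conclusion is written without quotients so that
  it can be read as a polynomial identity later.\<close>

lemma det_add_outer:
  fixes a u w :: "nat \<Rightarrow> real"
  assumes a: "\<And>i. i < n \<Longrightarrow> a i \<noteq> 0"
  shows "det (mat n n (\<lambda>(i, j). (if i = j then a i else 0) + u i * w j))
    = (\<Prod>i<n. a i) + (\<Sum>j<n. u j * w j * (\<Prod>i\<in>{..<n} - {j}. a i))"
proof -
  define A where "A = mat n n (\<lambda>(i, j). if i = j then a i else 0)"
  define B where "B = mat n 1 (\<lambda>(i, j). - u i)"
  define C where "C = mat 1 n (\<lambda>(i, j). w j)"
  define E where "E = mat 1 n (\<lambda>(i, j). - w j / a j)"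
  define M where "M = mat n n (\<lambda>(i, j). (if i = j then a i else 0) + u i * w j)"
  define N where "N = four_block_mat A B C (1\<^sub>m 1)"
  define t where "t = 1 + (\<Sum>j<n. u j * w j / a j)"
  note defs = A_def B_def C_def E_def M_def
  have carr: "A \<in> carrier_mat n n" "B \<in> carrier_mat n 1" "C \<in> carrier_mat 1 n" "E \<in> carrier_mat 1 n" "M \<in> carrier_mat n n"
    by (auto simp: defs)
  have N: "N \<in> carrier_mat (n + 1) (n + 1)" using four_block_carrier_mat[OF carr(1) one_carrier_mat[of 1]] by (simp add: N_def)
  have "det A = (\<Prod>i<n. a i)"
    by (subst det_upper_triangular[OF _ carr(1)])
      (auto simp: A_def diag_mat_def prod.list_conv_set_nth lessThan_atLeast0)
  \<comment> \<open>Clearing the row \<open>C\<close> by column operations adds the outer product to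
    the diagonal block.\<close>
  have 1: "N * four_block_mat (1\<^sub>m n) (0\<^sub>m n 1) (- C) (1\<^sub>m 1) = four_block_mat M B (0\<^sub>m 1 n) (1\<^sub>m 1)"
  proof -
    have "A * 1\<^sub>m n + B * - C = M" by (rule eq_matI) (auto simp: defs scalar_prod_def)
    moreover have "C * 1\<^sub>m n + 1\<^sub>m 1 * - C = 0\<^sub>m 1 n" using carr by auto
    ultimately show ?thesis unfolding N_def using carr
      by (subst mult_four_block_mat[of _ n n _ 1 _ 1 _ _ n _ 1]) auto
  qed
  \<comment> \<open>Clearing the row \<open>C\<close> by row operations, with multipliers
    \<open>- w j / a j\<close>, leaves the Schur complement \<open>t\<close> in the corner.\<close>
  have 2: "four_block_mat (1\<^sub>m n) (0\<^sub>m n 1) E (1\<^sub>m 1) * N = four_block_mat A B (0\<^sub>m 1 n) (mat 1 1 (\<lambda>_. t))"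
  proof -
    have "E * A + 1\<^sub>m 1 * C = 0\<^sub>m 1 n"
    proof (rule eq_matI)
      fix i j assume "i < dim_row (0\<^sub>m 1 n)" "j < dim_col (0\<^sub>m 1 n)"
      then have j: "i = 0" "j < n" by auto
      have "(E * A) $$ (0, j) = (\<Sum>k<n. if k = j then - w j else 0)"
        using j a by (simp add: defs scalar_prod_def lessThan_atLeast0 del: sum.delta) (intro sum.cong; simp)
      then show "(E * A + 1\<^sub>m 1 * C) $$ (i, j) = 0\<^sub>m 1 n $$ (i, j)"
        using j carr by (simp add: C_def)
    qed (use carr in auto)
    moreover have "E * B + 1\<^sub>m 1 * 1\<^sub>m 1 = mat 1 1 (\<lambda>_. t)"
      by (rule eq_matI) (auto simp: defs t_def scalar_prod_def lessThan_atLeast0 mult_ac intro!: sum.cong)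
    ultimately show ?thesis unfolding N_def using carr
      by (subst mult_four_block_mat[of _ n n _ 1 _ 1 _ _ n _ 1]) auto
  qed
  have tri: "det (four_block_mat (1\<^sub>m n) (0\<^sub>m n 1) X (1\<^sub>m 1)) = (1::real)" if "X \<in> carrier_mat 1 n" for X
    using that by (subst det_four_block_mat_upper_right_zero[of _ n _ 1]) auto
  have "det N = det M"
    using arg_cong[OF 1, of det] carr tri[of "- C"]
    by (subst (asm) det_mult[OF N]) (auto simp: det_four_block_mat_lower_left_zero[of _ n _ 1])
  moreover have "det N = det A * t"
    using arg_cong[OF 2, of det] carr tri[of E]
    by (subst (asm) det_mult[OF _ N]) (auto simp: det_four_block_mat_lower_left_zero[of _ n _ 1] det_single[of _])
  ultimately have "det M = (\<Prod>i<n. a i) * t" using \<open>det A = _\<close> by simp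
  also have "\<dots> = (\<Prod>i<n. a i) + (\<Sum>j<n. u j * w j * (\<Prod>i\<in>{..<n} - {j}. a i))"
  proof -
    have "(\<Prod>i<n. a i) * (u j * w j / a j) = u j * w j * (\<Prod>i\<in>{..<n} - {j}. a i)" if "j < n" for j
      using a[OF that] that by (subst prod.remove[of "{..<n}" j]) auto
    then show ?thesis unfolding t_def by (simp add: distrib_left sum_distrib_left)
  qed
  finally show ?thesis by (simp add: M_def)
qed

section \<open>Rank-one downdates of a Gram matrix\<close>

definition rev_char_poly :: "real mat \<Rightarrow> real poly" where
  "rev_char_poly G = det (mat (dim_row G) (dim_row G) (\<lambda>(i, j). [:if i = j then 1 else 0, G $$ (i, j):]))"

lemma poly_rev_char_poly:
  assumes "G \<in> carrier_mat d d"
  shows "poly (rev_char_poly G) y = det (1\<^sub>m d + y \<cdot>\<^sub>m G)"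
  unfolding rev_char_poly_def
  by (rule poly_det_cong[of _ d]) (use assms in auto)

lemma char_poly_eq_rev_char_poly:
  assumes G: "G \<in> carrier_mat d d" and "x \<noteq> 0"
  shows "poly (char_poly G) x = x ^ d * poly (rev_char_poly G) (- 1 / x)"
proof -
  have "- char_matrix G x = x \<cdot>\<^sub>m (1\<^sub>m d + (- 1 / x) \<cdot>\<^sub>m G)"
    using assms by (intro eq_matI) (auto simp: char_matrix_def field_simps)
  then show ?thesis
    using G by (simp add: char_poly_matrix[OF G] poly_rev_char_poly[OF G])
qed

text \<open>For a nonzero pivot this is elimination of row and column \<open>i\<close>, both of
  which become zero. For a zero pivot, division by zero yields \<open>G\<close> itself, which is why
  the uses below guard the pivot.\<close>

definition schur_downdate :: "real mat \<Rightarrow> nat \<Rightarrow> real mat" where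
  "schur_downdate G i = mat (dim_row G) (dim_row G) (\<lambda>(p, q). G $$ (p, q) - G $$ (p, i) * G $$ (i, q) / G $$ (i, i))"

definition drop_factor :: "nat \<Rightarrow> (nat \<Rightarrow> real) \<Rightarrow> nat \<Rightarrow> real poly" where
  "drop_factor d l j = (\<Prod>m\<in>{..<d} - {j}. [:1, l m:])"

text \<open>The eigenvalues are nonnegative because the diagonal factor equals the Gram matrix of
  \<open>B * U\<close>, whose diagonal entries are squared column norms.\<close>

lemma gram_spectral:
  fixes B :: "real mat"
  assumes B: "B \<in> carrier_mat n d" and G: "G = transpose_mat B * B"
  obtains U l where "U \<in> carrier_mat d d" "transpose_mat U * U = 1\<^sub>m d" "U * transpose_mat U = 1\<^sub>m d"
    "\<And>j. j < d \<Longrightarrow> (0::real) \<le> l j"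
    "\<And>p q. p < d \<Longrightarrow> q < d \<Longrightarrow> G $$ (p, q) = (\<Sum>j<d. U $$ (p, j) * l j * U $$ (q, j))"
proof -
  have Gc: "G \<in> carrier_mat d d" using B G by simp
  have "transpose_mat G = G" using B by (simp add: G transpose_mult[of _ d n _ d])
  then obtain U D where U: "U \<in> carrier_mat d d" and D: "D \<in> carrier_mat d d" "diagonal_mat D"
    and UtU: "transpose_mat U * U = 1\<^sub>m d" and GU: "G = U * D * transpose_mat U"
    using real_spectral_theorem[OF Gc] by blast
  have UUt: "U * transpose_mat U = 1\<^sub>m d"
    using mat_mult_left_right_inverse[OF _ U UtU] U by simp
  have "D = (transpose_mat U * U) * D * (transpose_mat U * U)" using D UtU by simp
  also have "\<dots> = transpose_mat U * G * U"
    using U D by (simp add: GU assoc_mult_mat[of _ d d _ d _ d])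
  also have "\<dots> = transpose_mat (B * U) * (B * U)"
    using U B by (simp add: G transpose_mult[of _ n d _ d] assoc_mult_mat[of _ d d _ d _ d]
        assoc_mult_mat[of _ d n _ d _ d] assoc_mult_mat[of _ d d _ n _ d])
  finally have DB: "D = transpose_mat (B * U) * (B * U)" .
  have "0 \<le> D $$ (j, j)" if "j < d" for j
    using that U B by (simp add: DB scalar_prod_def sum_nonneg)
  moreover have "G $$ (p, q) = (\<Sum>j<d. U $$ (p, j) * D $$ (j, j) * U $$ (q, j))" if "p < d" "q < d" for p q
  proof -
    have "(U * D) $$ (p, j) = U $$ (p, j) * D $$ (j, j)" if "j < d" for j
    proof -
      have "(U * D) $$ (p, j) = (\<Sum>k<d. if k = j then U $$ (p, j) * D $$ (j, j) else 0)"
        using that \<open>p < d\<close> U D by (auto simp: scalar_prod_def lessThan_atLeast0 diagonal_mat_def simp del: sum.delta intro!: sum.cong)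
      then show ?thesis using that by simp
    qed
    then show ?thesis
      unfolding GU using that U D by (simp add: scalar_prod_def lessThan_atLeast0 del: assoc_mult_mat)
  qed
  ultimately show ?thesis using that[of U "\<lambda>j. D $$ (j, j)"] U UtU UUt by blast
qed

text \<open>Here \<^term>\<open>c i j\<close> is the squared \<^term>\<open>i\<close>-th coordinate of the \<^term>\<open>j\<close>-th
  eigenvector of \<^term>\<open>G\<close>.\<close>

lemma rev_char_poly_schur_downdate:
  fixes B :: "real mat"
  assumes B: "B \<in> carrier_mat n d" and G: "G = transpose_mat B * B"
  obtains l c where "\<And>j. j < d \<Longrightarrow> (0::real) \<le> l j" "\<And>i j. (0::real) \<le> c i j"
    "\<And>j. j < d \<Longrightarrow> (\<Sum>i<d. c i j) = 1"
    "rev_char_poly G = (\<Prod>j<d. [:1, l j:])"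
    "\<And>i. i < d \<Longrightarrow> G $$ (i, i) = (\<Sum>j<d. c i j * l j)"
    "\<And>i. i < d \<Longrightarrow> G $$ (i, i) \<noteq> 0 \<Longrightarrow> Polynomial.smult (G $$ (i, i)) (rev_char_poly (schur_downdate G i))
       = (\<Sum>j<d. Polynomial.smult (c i j * l j) (drop_factor d l j))"
proof -
  have Gc: "G \<in> carrier_mat d d" using B G by simp
  obtain U l where U: "U \<in> carrier_mat d d" "transpose_mat U * U = 1\<^sub>m d" "U * transpose_mat U = 1\<^sub>m d"
    and l: "\<And>j. j < d \<Longrightarrow> 0 \<le> l j"
    and GU: "\<And>p q. p < d \<Longrightarrow> q < d \<Longrightarrow> G $$ (p, q) = (\<Sum>j<d. U $$ (p, j) * l j * U $$ (q, j))"
    using gram_spectral[OF B G] by blast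
  define c where "c = (\<lambda>i j. (U $$ (i, j))\<^sup>2)"
  have orth: "(\<Sum>k<d. U $$ (p, k) * U $$ (q, k)) = (if p = q then 1 else 0)" if "p < d" "q < d" for p q
    using arg_cong[OF U(3), of "\<lambda>M. M $$ (p, q)"] that U(1) by (simp add: scalar_prod_def lessThan_atLeast0)
  have colsum: "(\<Sum>i<d. c i j) = 1" if "j < d" for j
    using arg_cong[OF U(2), of "\<lambda>M. M $$ (j, j)"] that U(1)
    by (simp add: scalar_prod_def lessThan_atLeast0 c_def power2_eq_square)
  have detU: "det U * det (transpose_mat U) = 1"
    using arg_cong[OF U(3), of det] U(1) by (simp add: det_mult[of _ d])
  \<comment> \<open>Conjugation by the orthogonal \<open>U\<close>, stated entrywise, moves the
    determinants below into the eigenbasis.\<close>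
  have conj: "det N = det K"
    if K: "K \<in> carrier_mat d d" and N: "N \<in> carrier_mat d d"
      and NK: "\<And>p q. p < d \<Longrightarrow> q < d \<Longrightarrow> N $$ (p, q) = (\<Sum>k<d. (\<Sum>m<d. U $$ (p, m) * K $$ (m, k)) * U $$ (q, k))"
    for K N
  proof -
    have "N = (U * K) * transpose_mat U"
      using K N U(1) NK by (intro eq_matI) (simp_all add: scalar_prod_def lessThan_atLeast0 del: assoc_mult_mat)
    then have "det N = det U * det (transpose_mat U) * det K"
      using K U(1) by (simp add: det_mult[of _ d])
    then show ?thesis by (simp add: detU)
  qed
  \<comment> \<open>In the eigenbasis the matrix is diag(1 + y l) minus s y v v^T, where v j is l j
    times the entry (i, j) of \<open>U\<close>. The parameter \<open>s\<close> covers
    \<open>G\<close> itself (s = 0) and the downdate (s the inverse pivot); y > 0 keeps the diagonal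
    invertible.\<close>
  have downdated: "det (1\<^sub>m d + y \<cdot>\<^sub>m mat d d (\<lambda>(p, q). G $$ (p, q) - s * (G $$ (p, i) * G $$ (i, q))))
      = (\<Prod>j<d. 1 + y * l j) - s * y * (\<Sum>j<d. c i j * (l j)\<^sup>2 * (\<Prod>m\<in>{..<d} - {j}. 1 + y * l m))"
    if y: "0 < y" and i: "i < d" for y s i
  proof -
    define v where "v = (\<lambda>j. l j * U $$ (i, j))"
    define K where "K = mat d d (\<lambda>(p, q). (if p = q then 1 + y * l p else 0) + (- s * y * v p) * v q)"
    have UK: "(\<Sum>m<d. U $$ (p, m) * K $$ (m, k)) = U $$ (p, k) * (1 + y * l k) - s * y * G $$ (p, i) * v k"
      if "p < d" "k < d" for p k
    proof -
      have "(\<Sum>m<d. U $$ (p, m) * K $$ (m, k))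
          = (\<Sum>m<d. (if m = k then U $$ (p, k) * (1 + y * l k) else 0) - s * y * v k * (U $$ (p, m) * l m * U $$ (i, m)))"
        using that by (intro sum.cong) (auto simp: K_def v_def algebra_simps)
      also have "\<dots> = U $$ (p, k) * (1 + y * l k) - s * y * v k * (\<Sum>m<d. U $$ (p, m) * l m * U $$ (i, m))"
        using that by (simp add: sum_subtractf sum_distrib_left[symmetric])
      finally show ?thesis using GU[OF that(1) i] by (simp add: mult_ac)
    qed
    have "det (1\<^sub>m d + y \<cdot>\<^sub>m mat d d (\<lambda>(p, q). G $$ (p, q) - s * (G $$ (p, i) * G $$ (i, q)))) = det K"
    proof (rule conj)
      fix p q assume pq: "p < d" "q < d"
      have "(\<Sum>k<d. (\<Sum>m<d. U $$ (p, m) * K $$ (m, k)) * U $$ (q, k))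
          = (\<Sum>k<d. U $$ (p, k) * U $$ (q, k) + y * (U $$ (p, k) * l k * U $$ (q, k))
             - s * y * G $$ (p, i) * (U $$ (i, k) * l k * U $$ (q, k)))"
        by (intro sum.cong refl) (subst UK, use pq in \<open>auto simp: v_def algebra_simps\<close>)
      also have "\<dots> = (if p = q then 1 else 0) + y * G $$ (p, q) - s * y * G $$ (p, i) * G $$ (i, q)"
        unfolding sum_subtractf sum.distrib sum_distrib_left[symmetric] orth[OF pq] GU[OF pq] GU[OF i pq(2)] ..
      finally show "(1\<^sub>m d + y \<cdot>\<^sub>m mat d d (\<lambda>(p, q). G $$ (p, q) - s * (G $$ (p, i) * G $$ (i, q)))) $$ (p, q)
          = (\<Sum>k<d. (\<Sum>m<d. U $$ (p, m) * K $$ (m, k)) * U $$ (q, k))"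
        using pq by (simp add: algebra_simps)
    qed (simp_all add: K_def)
    also have "det K = (\<Prod>j<d. 1 + y * l j) + (\<Sum>j<d. (- s * y * v j) * v j * (\<Prod>m\<in>{..<d} - {j}. 1 + y * l m))"
      unfolding K_def
    proof (rule det_add_outer)
      fix j assume "j < d"
      then have "0 \<le> y * l j" using l y by simp
      then show "1 + y * l j \<noteq> 0" by linarith
    qed
    also have "(\<Sum>j<d. (- s * y * v j) * v j * (\<Prod>m\<in>{..<d} - {j}. 1 + y * l m))
        = - s * y * (\<Sum>j<d. c i j * (l j)\<^sup>2 * (\<Prod>m\<in>{..<d} - {j}. 1 + y * l m))"
      by (simp add: sum_distrib_left v_def c_def power2_eq_square mult_ac sum_negf)
    finally show ?thesis by simp
  qed
  \<comment> \<open>Agreement at infinitely many points suffices, so the restriction to y > 0 costs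
    no generality.\<close>
  have poly_eqI_pos: "P = Q" if "\<And>y. 0 < y \<Longrightarrow> poly P y = poly Q y" for P Q :: "real poly"
  proof (rule ccontr)
    assume "P \<noteq> Q"
    then have "finite {y. poly (P - Q) y = 0}" by (intro poly_roots_finite) simp
    moreover have "{0<..} \<subseteq> {y. poly (P - Q) y = 0}" using that by auto
    ultimately show False using infinite_Ioi[of "0::real"] finite_subset by blast
  qed
  have R: "rev_char_poly G = (\<Prod>j<d. [:1, l j:])"
  \<comment> \<open>\<open>downdated\<close> mentions an index below \<open>d\<close> even when s =
    0, so the empty matrix is separate.\<close>
  proof (cases "d = 0")
    case True
    then show ?thesis using Gc by (simp add: rev_char_poly_def)
  next
    case False
    show ?thesis
    proof (rule poly_eqI_pos)
      fix y :: real assume y: "0 < y"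
      have "mat d d (\<lambda>(p, q). G $$ (p, q) - 0 * (G $$ (p, 0) * G $$ (0, q))) = G"
        using Gc by (intro eq_matI) auto
      then show "poly (rev_char_poly G) y = poly (\<Prod>j<d. [:1, l j:]) y"
        using downdated[OF y, of 0 0] False by (simp add: poly_rev_char_poly[OF Gc] poly_prod)
    qed
  qed
  have diag: "G $$ (i, i) = (\<Sum>j<d. c i j * l j)" if "i < d" for i
    unfolding GU[OF that that] c_def by (simp add: power2_eq_square mult_ac)
  have down: "Polynomial.smult (G $$ (i, i)) (rev_char_poly (schur_downdate G i))
       = (\<Sum>j<d. Polynomial.smult (c i j * l j) (drop_factor d l j))"
    if i: "i < d" and nz: "G $$ (i, i) \<noteq> 0" for i
  proof (rule poly_eqI_pos)
    fix y :: real assume y: "0 < y"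
    define w where "w = G $$ (i, i)"
    define tail where "tail = (\<lambda>j. \<Prod>m\<in>{..<d} - {j}. 1 + y * l m)"
    have sd: "schur_downdate G i = mat d d (\<lambda>(p, q). G $$ (p, q) - 1 / w * (G $$ (p, i) * G $$ (i, q)))"
      using Gc by (simp add: schur_downdate_def w_def)
    have c: "schur_downdate G i \<in> carrier_mat d d" by (simp add: sd)
    have full: "(\<Prod>j<d. 1 + y * l j) = (1 + y * l j) * tail j" if "j < d" for j
      using that by (simp add: tail_def prod.remove[of "{..<d}" j])
    have "w * poly (rev_char_poly (schur_downdate G i)) y
        = w * (\<Prod>j<d. 1 + y * l j) - y * (\<Sum>j<d. c i j * (l j)\<^sup>2 * tail j)"
      unfolding poly_rev_char_poly[OF c] unfolding sd downdated[OF y i] tail_def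
      using nz by (simp add: w_def right_diff_distrib)
    \<comment> \<open>Expanding the pivot as the sum of c i j l j puts both terms over the same
      index; then (1 + y l j) - y l j = 1 leaves exactly the products lacking one factor.\<close>
    also have "\<dots> = (\<Sum>j<d. c i j * l j * ((1 + y * l j) * tail j) - y * (c i j * (l j)\<^sup>2 * tail j))"
      unfolding w_def diag[OF i] sum_distrib_right sum_distrib_left sum_subtractf
      using full by (intro arg_cong2[of _ _ _ _ minus] sum.cong) auto
    also have "\<dots> = (\<Sum>j<d. c i j * l j * tail j)"
      by (intro sum.cong) (auto simp: algebra_simps power2_eq_square)
    finally show "poly (Polynomial.smult (G $$ (i, i)) (rev_char_poly (schur_downdate G i))) y
      = poly (\<Sum>j<d. Polynomial.smult (c i j * l j) (drop_factor d l j)) y"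
      by (simp add: poly_sum drop_factor_def poly_prod tail_def w_def)
  qed
  show ?thesis
    by (rule that[OF l _ colsum R diag down]) (auto simp: c_def)
qed

section \<open>Coefficients of products of linear factors and a single selection step\<close>

lemma real_rooted_one_linear: "real_rooted [:1, l:]"
proof -
  have "map_poly complex_of_real [:1, l:] = [:1, of_real l:]"
    by (rule poly_eqI) (simp add: coeff_map_poly coeff_pCons split: nat.split)
  then show ?thesis unfolding real_rooted_def by (auto simp: complex_eq_iff)
qed

lemma real_rooted_prod: "(\<And>j. j \<in> J \<Longrightarrow> real_rooted (f j)) \<Longrightarrow> real_rooted (\<Prod>j\<in>J. f j)"
proof (induction J rule: infinite_finite_induct)
  case (insert x F)
  then show ?case by (simp add: real_rooted_mult)
qed (auto simp: real_rooted_def)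

text \<open>There are no gaps below the degree: a factor with l = 0 is 1 and changes nothing, while
  one with l > 0 adds a positive shifted copy. Strict positivity is what later identifies the
  nonzero constant terms of derivatives.\<close>

lemma coeff_prod_one_linear:
  assumes "finite J" "\<And>j. j \<in> J \<Longrightarrow> (0::real) \<le> l j"
  shows "0 \<le> coeff (\<Prod>j\<in>J. [:1, l j:]) i
    \<and> (i \<le> degree (\<Prod>j\<in>J. [:1, l j:]) \<longrightarrow> 0 < coeff (\<Prod>j\<in>J. [:1, l j:]) i)"
  using assms
proof (induction J arbitrary: i rule: finite_induct)
  case empty
  then show ?case by (cases i) auto
next
  case (insert x F)
  define p where "p = (\<Prod>j\<in>F. [:1, l j:])"
  have p: "0 \<le> coeff p i" "i \<le> degree p \<Longrightarrow> 0 < coeff p i" for i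
    using insert.IH[of i] insert.prems by (auto simp: p_def)
  have prod: "(\<Prod>j\<in>insert x F. [:1, l j:]) = p + pCons 0 (Polynomial.smult (l x) p)"
    using insert.hyps by (simp add: p_def)
  have lx: "0 \<le> l x" using insert.prems by simp
  show ?case
  proof (cases "l x = 0")
    case True
    then show ?thesis unfolding prod using p by simp
  next
    case False
    have "degree (p + pCons 0 (Polynomial.smult (l x) p)) \<le> Suc (degree p)"
      by (intro degree_add_le) (auto intro: order_trans[OF degree_pCons_le])
    moreover have "0 \<le> coeff (p + pCons 0 (Polynomial.smult (l x) p)) i" using p lx by (cases i) auto
    moreover have "0 < coeff (p + pCons 0 (Polynomial.smult (l x) p)) i" if "i \<le> Suc (degree p)"
    proof (cases i)
      case 0
      then show ?thesis using p by simp
    next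
      case (Suc k)
      then have "0 < l x * coeff p k" using that p(2)[of k] lx False by simp
      then show ?thesis using Suc p(1)[of i] by simp
    qed
    ultimately show ?thesis unfolding prod by auto
  qed
qed

lemma rev_char_poly_gram_factorization:
  assumes "B \<in> carrier_mat n d" "G = transpose_mat B * B"
  obtains l where "\<And>j. j < d \<Longrightarrow> (0::real) \<le> l j" "rev_char_poly G = (\<Prod>j<d. [:1, l j:])"
  by (rule rev_char_poly_schur_downdate[OF assms]) (use that in blast)

lemma nonneg_coeffs_rev_char_poly:
  assumes "B \<in> carrier_mat n d" "G = transpose_mat B * B"
  shows "nonneg_coeffs (rev_char_poly G)"
proof -
  obtain l where l: "\<And>j. j < d \<Longrightarrow> 0 \<le> l j" "rev_char_poly G = (\<Prod>j<d. [:1, l j:])"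
    using rev_char_poly_gram_factorization[OF assms] by blast
  then show ?thesis
    using coeff_prod_one_linear[of "{..<d}" l] by (auto simp: nonneg_coeffs_def)
qed

text \<open>The constant term of the k-th derivative is a nonzero multiple of the coefficient of
  order k, which is positive up to the degree. This excludes y = 0, the counterpart of an infinite
  root in x.\<close>

lemma poly_0_pderiv_funpow_rev_char_poly:
  assumes "B \<in> carrier_mat n d" "G = transpose_mat B * B" "(pderiv ^^ k) (rev_char_poly G) \<noteq> 0"
  shows "poly ((pderiv ^^ k) (rev_char_poly G)) 0 \<noteq> 0"
proof -
  obtain l where l: "\<And>j. j < d \<Longrightarrow> 0 \<le> l j" "rev_char_poly G = (\<Prod>j<d. [:1, l j:])"
    using rev_char_poly_gram_factorization[OF assms(1,2)] by blast
  have "k \<le> degree (rev_char_poly G)"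
  proof (rule ccontr)
    assume "\<not> ?thesis"
    then have "(pderiv ^^ k) (rev_char_poly G) = 0"
      by (intro poly_eqI) (simp add: coeff_higher_pderiv coeff_eq_0)
    with assms(3) show False ..
  qed
  then have "0 < coeff (rev_char_poly G) k"
    using coeff_prod_one_linear[of "{..<d}" l k] l by auto
  then show ?thesis by (simp add: poly_0_coeff_0 coeff_higher_pderiv pochhammer_eq_0_iff)
qed

text \<open>The assumptions on the downdated polynomials range over all admissible pivots, since the
  favourable one is known only after the comparison; the recursion over the selections provides
  them.\<close>

lemma schur_downdate_step:
  assumes B: "B \<in> carrier_mat n d" and G: "G = transpose_mat B * B"
    and nn: "\<And>i. i < d \<Longrightarrow> G $$ (i, i) \<noteq> 0 \<Longrightarrow> nonneg_coeffs (rev_char_poly (schur_downdate G i))"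
    and nz: "\<And>i. i < d \<Longrightarrow> G $$ (i, i) \<noteq> 0 \<Longrightarrow> (pderiv ^^ k) (rev_char_poly (schur_downdate G i)) \<noteq> 0"
    and ex: "\<exists>i<d. G $$ (i, i) \<noteq> 0"
  shows "(pderiv ^^ Suc k) (rev_char_poly G) \<noteq> 0"
    and "\<exists>i<d. G $$ (i, i) \<noteq> 0 \<and>
      roots_below ((pderiv ^^ k) (rev_char_poly (schur_downdate G i))) ((pderiv ^^ Suc k) (rev_char_poly G))"
proof -
  obtain l c where l: "\<And>j. j < d \<Longrightarrow> 0 \<le> l j" and c: "\<And>i j. 0 \<le> c i j"
    and colsum: "\<And>j. j < d \<Longrightarrow> (\<Sum>i<d. c i j) = 1"
    and R: "rev_char_poly G = (\<Prod>j<d. [:1, l j:])"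
    and diag: "\<And>i. i < d \<Longrightarrow> G $$ (i, i) = (\<Sum>j<d. c i j * l j)"
    and down: "\<And>i. i < d \<Longrightarrow> G $$ (i, i) \<noteq> 0 \<Longrightarrow> Polynomial.smult (G $$ (i, i)) (rev_char_poly (schur_downdate G i))
       = (\<Sum>j<d. Polynomial.smult (c i j * l j) (drop_factor d l j))"
    by (rule rev_char_poly_schur_downdate[OF B G]) (rule that; assumption)
  define I where "I = {i. i < d \<and> G $$ (i, i) \<noteq> 0}"
  define r where "r = (\<lambda>i. rev_char_poly (schur_downdate G i))"
  define w where "w = (\<lambda>i. G $$ (i, i))"
  have cl: "0 \<le> c i j * l j" if "j < d" for i j using c l[OF that] by simp
  have w_pos: "0 < w i" if "i \<in> I" for i
    using that diag[of i] cl by (auto simp: I_def w_def less_le intro!: sum_nonneg)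
  \<comment> \<open>A zero pivot is a sum of nonnegative terms, so all of them vanish. Indices at
    which the downdate is meaningless thus contribute nothing to the derivative.\<close>
  have null: "c i j * l j = 0" if "i < d" "i \<notin> I" "j < d" for i j
  proof -
    have "(\<Sum>j<d. c i j * l j) = 0" using that diag[of i] by (auto simp: I_def)
    then show ?thesis using cl that by (subst (asm) sum_nonneg_eq_0_iff) auto
  qed
  \<comment> \<open>Product rule, with the coefficient l j spread over the indices i by means of the
    unit column sums of \<open>c\<close>.\<close>
  have "pderiv (rev_char_poly G) = (\<Sum>j<d. Polynomial.smult (l j) (drop_factor d l j))"
    unfolding R pderiv_prod drop_factor_def by (intro sum.cong) (auto simp: pderiv_pCons mult.commute)
  also have "\<dots> = (\<Sum>j<d. Polynomial.smult ((\<Sum>i<d. c i j) * l j) (drop_factor d l j))"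
    using colsum by (intro sum.cong) auto
  also have "\<dots> = (\<Sum>j<d. \<Sum>i<d. Polynomial.smult (c i j * l j) (drop_factor d l j))"
    by (simp add: sum_distrib_right smult_sum)
  also have "\<dots> = (\<Sum>i<d. \<Sum>j<d. Polynomial.smult (c i j * l j) (drop_factor d l j))" by (rule sum.swap)
  also have "\<dots> = (\<Sum>i\<in>I. \<Sum>j<d. Polynomial.smult (c i j * l j) (drop_factor d l j))"
    by (rule sum.mono_neutral_right) (auto simp: I_def null[unfolded I_def])
  also have "\<dots> = (\<Sum>i\<in>I. Polynomial.smult (w i) (r i))"
    using down by (intro sum.cong) (auto simp: I_def w_def r_def)
  finally have deriv: "pderiv (rev_char_poly G) = (\<Sum>i\<in>I. Polynomial.smult (w i) (r i))" .
  define g where "g = (pderiv ^^ k) (rev_char_poly G)"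
  have sum: "pderiv g = (\<Sum>i\<in>I. Polynomial.smult (w i) ((pderiv ^^ k) (r i)))"
    using arg_cong[OF deriv, of "pderiv ^^ k"]
    by (simp add: g_def pderiv_funpow_sum pderiv_funpow_smult flip: funpow_swap1)
  have fin: "finite I" by (simp add: I_def)
  have f: "nonneg_coeffs ((pderiv ^^ k) (r i))" "(pderiv ^^ k) (r i) \<noteq> 0" if "i \<in> I" for i
    using nn nz that nonneg_coeffs_pderiv_funpow by (auto simp: I_def r_def)
  obtain i where i: "i \<in> I" using ex by (auto simp: I_def)
  \<comment> \<open>Any positive argument would do: positive weights times positive values cannot
    cancel.\<close>
  have "0 < poly (pderiv g) 1"
    unfolding sum poly_sum poly_smult
    by (intro sum_pos mult_pos_pos w_pos nonneg_coeffs_poly_pos f fin) (use i in auto)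
  then show nz': "(pderiv ^^ Suc k) (rev_char_poly G) \<noteq> 0" by (auto simp: g_def)
  have rr: "real_rooted (pderiv g)"
    using real_rooted_pderiv_funpow[of "rev_char_poly G" "Suc k"] nz'
    by (simp add: g_def R real_rooted_prod real_rooted_one_linear)
  \<comment> \<open>The Wronskian with the fixed \<open>g\<close> is linear in its first argument,
    and for the j-th quotient the original polynomial is that quotient times [:1, l j:].\<close>
  have W: "poly (wronskian ((pderiv ^^ k) (r i)) g) y \<le> 0" if "i \<in> I" for i y
  proof -
    have Rj: "rev_char_poly G = [:1, l j:] * drop_factor d l j" if "j < d" for j
      using that by (simp add: R drop_factor_def prod.remove[of "{..<d}" j] del: mult_pCons_left)
    define q where "q = (\<lambda>j. (pderiv ^^ k) (drop_factor d l j))"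
    have eq: "Polynomial.smult (w i) ((pderiv ^^ k) (r i)) = (\<Sum>j<d. Polynomial.smult (c i j * l j) (q j))"
      using arg_cong[OF down[of i], of "pderiv ^^ k"] that
      by (simp add: I_def w_def r_def q_def pderiv_funpow_sum pderiv_funpow_smult)
    have "poly (wronskian (Polynomial.smult (w i) ((pderiv ^^ k) (r i))) g) y
        = (\<Sum>j<d. c i j * l j * poly (wronskian (q j) g) y)"
      unfolding eq wronskian_def
      by (simp add: pderiv_sum pderiv_smult poly_sum sum_distrib_right sum_subtractf[symmetric])
         (intro sum.cong refl, simp add: algebra_simps)
    also have "\<dots> \<le> 0"
    proof (intro sum_nonpos mult_nonneg_nonpos cl)
      fix j assume j: "j \<in> {..<d}"
      have "real_rooted (drop_factor d l j)"
        unfolding drop_factor_def by (intro real_rooted_prod real_rooted_one_linear)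
      then show "poly (wronskian (q j) g) y \<le> 0"
        using wronskian_pderiv_funpow_linear_mult[of "drop_factor d l j" "l j" k y] l j
        by (simp add: q_def g_def Rj[of j] del: mult_pCons_left)
    qed auto
    finally have "w i * poly (wronskian ((pderiv ^^ k) (r i)) g) y \<le> 0"
      by (simp add: wronskian_def pderiv_smult algebra_simps)
    then show ?thesis using w_pos[OF that] by (simp add: mult_le_0_iff)
  qed
  have "\<exists>i\<in>I. roots_below ((pderiv ^^ k) (r i)) (pderiv g)"
    by (rule exists_roots_below[OF fin sum w_pos W f rr]) (use nz' in \<open>auto simp: g_def\<close>)
  then show "\<exists>i<d. G $$ (i, i) \<noteq> 0 \<and>
      roots_below ((pderiv ^^ k) (rev_char_poly (schur_downdate G i))) ((pderiv ^^ Suc k) (rev_char_poly G))"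
    by (auto simp: I_def r_def g_def)
qed

section \<open>Selecting columns\<close>

text \<open>\<^term>\<open>P\<close> is the orthogonal projector onto the span of the linearly independent
  columns of \<^term>\<open>A\<close> indexed by \<^term>\<open>S\<close>.\<close>

definition column_projector :: "real mat \<Rightarrow> nat set \<Rightarrow> real mat \<Rightarrow> bool" where
  "column_projector A S P \<longleftrightarrow>
    P \<in> carrier_mat (dim_row A) (dim_row A) \<and> transpose_mat P = P \<and>
    (\<forall>s\<in>S. P *\<^sub>v col A s = col A s) \<and>
    (\<exists>Y\<in>carrier_mat (dim_col A) (dim_row A). P = A * Y \<and>
      (\<forall>s<dim_col A. s \<notin> S \<longrightarrow> (\<forall>q<dim_row A. Y $$ (s, q) = 0))) \<and>
    (\<forall>v\<in>carrier_vec (dim_col A). (\<forall>s<dim_col A. s \<notin> S \<longrightarrow> v $ s = 0) \<longrightarrow>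
      A *\<^sub>v v = 0\<^sub>v (dim_row A) \<longrightarrow> v = 0\<^sub>v (dim_col A))"

definition residual_gram :: "real mat \<Rightarrow> real mat \<Rightarrow> real mat" where
  "residual_gram A P = transpose_mat A * (1\<^sub>m (dim_row A) - P) * A"

lemma mult_mat_unit_vec:
  assumes "A \<in> carrier_mat n d" "i < d"
  shows "A *\<^sub>v unit_vec d i = (col A i :: real vec)"
  using assms col_mult2[of A n d "1\<^sub>m d" d i] by (simp del: col_mult)

context
  fixes A :: "real mat" and n d :: nat and S :: "nat set" and P :: "real mat"
  assumes A: "A \<in> carrier_mat n d" and S: "S \<subseteq> {..<d}" and proj: "column_projector A S P"
begin

lemma projector_carrier: "P \<in> carrier_mat n n" "transpose_mat P = P"
  using proj A by (auto simp: column_projector_def)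

lemma residual_carrier: "1\<^sub>m n - P \<in> carrier_mat n n"
  using projector_carrier(1) by (rule minus_carrier_mat)

lemma projector_fixes:
  assumes v: "v \<in> carrier_vec d" "\<And>s. s < d \<Longrightarrow> s \<notin> S \<Longrightarrow> v $ s = 0"
  shows "P *\<^sub>v (A *\<^sub>v v) = A *\<^sub>v v"
proof -
  have PA: "(P * A) $$ (p, s) = A $$ (p, s)" if "p < n" "s \<in> S" for p s
  proof -
    have "col (P * A) s = col A s"
      using proj A S that projector_carrier by (subst col_mult2[of _ n n _ d]) (auto simp: column_projector_def)
    then show ?thesis using that S A projector_carrier(1)
      by (metis (no_types, lifting) carrier_matD index_col index_mult_mat(2,3) lessThan_iff subsetD)
  qed
  have "P *\<^sub>v (A *\<^sub>v v) = (P * A) *\<^sub>v v"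
    using projector_carrier(1) A v(1) by (simp add: assoc_mult_mat_vec[of _ n n _ d])
  also have "\<dots> = A *\<^sub>v v"
  proof (rule eq_vecI)
    fix p assume "p < dim_vec (A *\<^sub>v v)"
    then have p: "p < n" using A by simp
    have "((P * A) *\<^sub>v v) $ p = (\<Sum>s<d. (P * A) $$ (p, s) * v $ s)"
      using p A v(1) projector_carrier(1) by (simp add: scalar_prod_def lessThan_atLeast0 del: assoc_mult_mat_vec)
    also have "\<dots> = (\<Sum>s<d. A $$ (p, s) * v $ s)"
      using PA[OF p] v(2) by (intro sum.cong refl) (metis lessThan_iff mult_zero_right)
    also have "\<dots> = (A *\<^sub>v v) $ p"
      using p A v(1) by (simp add: scalar_prod_def lessThan_atLeast0)
    finally show "((P * A) *\<^sub>v v) $ p = (A *\<^sub>v v) $ p" .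
  qed (use A projector_carrier in auto)
  finally show ?thesis .
qed

lemma projector_factor:
  obtains Y where "Y \<in> carrier_mat d n" "P = A * Y" "\<And>s q. s < d \<Longrightarrow> s \<notin> S \<Longrightarrow> q < n \<Longrightarrow> Y $$ (s, q) = 0"
  using proj A unfolding column_projector_def by force

text \<open>Each column of P is a combination of selected columns, by the factorisation P = A Y with
  Y supported on S, and P fixes those.\<close>

lemma projector_idem: "P * P = P"
proof -
  obtain Y where Y: "Y \<in> carrier_mat d n" "P = A * Y" "\<And>s q. s < d \<Longrightarrow> s \<notin> S \<Longrightarrow> q < n \<Longrightarrow> Y $$ (s, q) = 0"
    using projector_factor by blast
  have "col (P * P) q = col P q" if q: "q < n" for q
  proof -
    have "col P q = A *\<^sub>v col Y q" using Y(1,2) A q by (simp add: col_mult2[of _ n d _ n] del: col_mult)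
    moreover have "P *\<^sub>v (A *\<^sub>v col Y q) = A *\<^sub>v col Y q"
      by (rule projector_fixes) (use Y q in auto)
    ultimately show ?thesis using projector_carrier(1) q by (simp add: col_mult2[of _ n n _ n] del: col_mult)
  qed
  then show ?thesis using projector_carrier(1) by (intro mat_col_eqI) auto
qed

text \<open>Symmetry and idempotence of I - P turn the residual into a genuine Gram matrix, the form
  required by the spectral lemmas.\<close>

lemma residual_gram_eq:
  "residual_gram A P = transpose_mat ((1\<^sub>m n - P) * A) * ((1\<^sub>m n - P) * A)"
proof -
  let ?R = "1\<^sub>m n - P"
  note R = residual_carrier
  have Rt: "transpose_mat ?R = ?R" using projector_carrier by (simp add: transpose_minus[of _ n n])
  have "?R * ?R = ?R - (P - P)"
    using projector_carrier(1) projector_idem R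
    by (simp add: minus_mult_distrib_mat[of _ n n _ _ n] mult_minus_distrib_mat[of _ n n _ n])
  then have "?R * ?R = ?R" using projector_carrier(1) by (intro eq_matI) auto
  then have "transpose_mat A * ?R * A = transpose_mat A * (?R * ?R) * A" by simp
  also have "\<dots> = transpose_mat (?R * A) * (?R * A)"
    using R A by (simp add: transpose_mult[of _ n n _ d] Rt assoc_mult_mat[of _ d n _ n _ n]
        assoc_mult_mat[of _ d n _ n _ d] assoc_mult_mat[of _ n n _ n _ d])
  finally show ?thesis using A by (simp add: residual_gram_def)
qed

lemma residual_gram_carrier: "residual_gram A P \<in> carrier_mat d d"
  using A by (intro carrier_matI) (auto simp: residual_gram_def)

lemma residual_gram_index:
  assumes "p < d" "q < d"
  shows "residual_gram A P $$ (p, q) = col A p \<bullet> ((1\<^sub>m n - P) *\<^sub>v col A q)"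
proof -
  have "residual_gram A P = transpose_mat A * ((1\<^sub>m n - P) * A)"
    using A residual_carrier by (simp add: residual_gram_def assoc_mult_mat[of _ d n _ n _ d])
  then show ?thesis using A residual_carrier assms by (simp add: col_mult2[of _ n n _ d] del: col_mult)
qed

lemma residual_gram_sym:
  assumes "p < d" "q < d"
  shows "residual_gram A P $$ (p, q) = residual_gram A P $$ (q, p)"
proof -
  have "transpose_mat (residual_gram A P) = residual_gram A P"
    unfolding residual_gram_eq using A residual_carrier by (simp add: transpose_mult[of _ d n _ d])
  from arg_cong[OF this, of "\<lambda>M. M $$ (q, p)"] show ?thesis
    using assms residual_gram_carrier by simp
qed

lemma residual_gram_diag:
  assumes "i < d"
  shows "residual_gram A P $$ (i, i) = ((1\<^sub>m n - P) *\<^sub>v col A i) \<bullet> ((1\<^sub>m n - P) *\<^sub>v col A i)"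
  unfolding residual_gram_eq using A residual_carrier assms by (simp add: col_mult2[of _ n n _ d] del: col_mult)

lemma residual_column:
  assumes "i < d"
  shows "(1\<^sub>m n - P) *\<^sub>v col A i = col A i - P *\<^sub>v col A i"
  using A projector_carrier assms by (simp add: minus_mult_distrib_mat_vec[of _ n n])

lemma residual_gram_selected:
  assumes "s \<in> S" "i < d"
  shows "residual_gram A P $$ (i, s) = 0"
proof -
  have s: "s < d" using assms S by auto
  have "(1\<^sub>m n - P) *\<^sub>v col A s = 0\<^sub>v n"
    using proj assms A s unfolding column_projector_def by (simp add: residual_column[OF s])
  then show ?thesis using assms s A by (simp add: residual_gram_index)
qed

text \<open>A Gram-Schmidt step: b is the part of column i orthogonal to the selected span, w its
  squared norm, and P' = P + b b^T / w. The products of b with the columns of A are the entries of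
  row i of the residual Gram matrix, so the correction is exactly the Schur downdate.\<close>

lemma projector_insert:
  assumes i: "i < d" and nz: "residual_gram A P $$ (i, i) \<noteq> 0"
  obtains P' where "column_projector A (insert i S) P'" "i \<notin> S"
    "residual_gram A P' = schur_downdate (residual_gram A P) i"
proof -
  define w where "w = residual_gram A P $$ (i, i)"
  define b where "b = (1\<^sub>m n - P) *\<^sub>v col A i"
  define E where "E = mat n n (\<lambda>(p, q). b $ p * b $ q / w)"
  note P = projector_carrier
  have b: "b \<in> carrier_vec n" using residual_carrier A i by (simp add: b_def)
  have b_eq: "b = col A i - P *\<^sub>v col A i" unfolding b_def by (rule residual_column[OF i])
  have iS: "i \<notin> S" using residual_gram_selected[of i i] i nz by blast
  have w: "w \<noteq> 0" "b \<bullet> b = w" using nz residual_gram_diag[OF i] by (auto simp: w_def b_def)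
  have ab: "col A p \<bullet> b = residual_gram A P $$ (p, i)" if "p < d" for p
    using residual_gram_index[OF that i] by (simp add: b_def)
  have ba: "b \<bullet> col A p = residual_gram A P $$ (i, p)" if "p < d" for p
    using ab[OF that] residual_gram_sym[OF that i] b A that by (metis col_carrier_vec carrier_matD(2) comm_scalar_prod)
  have Ec: "E \<in> carrier_mat n n" by (simp add: E_def)
  have Ev: "E *\<^sub>v x = (b \<bullet> x / w) \<cdot>\<^sub>v b" if "x \<in> carrier_vec n" for x
    using that b by (intro eq_vecI) (auto simp: E_def scalar_prod_def sum_distrib_left sum_divide_distrib mult_ac)
  define P' where "P' = P + E"
  have P': "P' \<in> carrier_mat n n" using P Ec by (simp add: P'_def)
  have "transpose_mat E = E" by (rule eq_matI) (auto simp: E_def)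
  then have P't: "transpose_mat P' = P'" using P Ec by (simp add: P'_def transpose_add[of _ n n])
  have P'v: "P' *\<^sub>v x = P *\<^sub>v x + (b \<bullet> x / w) \<cdot>\<^sub>v b" if "x \<in> carrier_vec n" for x
    using that P Ec Ev by (simp add: P'_def add_mult_distrib_mat_vec[of _ n n])
  have fix_new: "P' *\<^sub>v col A i = col A i"
  proof -
    have "P' *\<^sub>v col A i = P *\<^sub>v col A i + b" using P'v[of "col A i"] ba[OF i] w(1) A i by (simp add: w_def)
    then show ?thesis unfolding b_eq using P A i by (intro eq_vecI) auto
  qed
  have fix_old: "P' *\<^sub>v col A s = col A s" if s: "s \<in> S" for s
  proof -
    have "s < d" using s S by auto
    then have "b \<bullet> col A s = 0" using ba residual_gram_selected[OF s i] by simp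
    moreover have "P *\<^sub>v col A s = col A s" using proj s by (simp add: column_projector_def)
    ultimately show ?thesis using P'v[of "col A s"] A b \<open>s < d\<close> by (intro eq_vecI) auto
  qed
  obtain Y where Y: "Y \<in> carrier_mat d n" "P = A * Y" "\<And>s q. s < d \<Longrightarrow> s \<notin> S \<Longrightarrow> q < n \<Longrightarrow> Y $$ (s, q) = 0"
    using projector_factor by blast
  \<comment> \<open>Coefficients of b in the columns of A: e_i minus those of the projected column.
    They are supported on \<open>insert i S\<close>, and \<open>Z\<close> extends the factorisation
    of P to the added rank-one term.\<close>
  define z where "z = unit_vec d i - Y *\<^sub>v col A i"
  define Z where "Z = mat d n (\<lambda>(p, q). z $ p * b $ q / w)"
  have z: "z \<in> carrier_vec d" using Y A i by (simp add: z_def minus_carrier_vec)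
  have "A *\<^sub>v z = A *\<^sub>v unit_vec d i - A *\<^sub>v (Y *\<^sub>v col A i)"
    unfolding z_def using A Y i by (intro mult_minus_distrib_mat_vec) auto
  also have "\<dots> = b" unfolding b_eq Y(2)
    using A Y i by (simp add: mult_mat_unit_vec assoc_mult_mat_vec[of _ n d _ n])
  finally have Az: "A *\<^sub>v z = b" .
  have "A * Z = E"
  proof (rule eq_matI)
    fix p q assume "p < dim_row E" "q < dim_col E"
    then have pq: "p < n" "q < n" by (auto simp: E_def)
    have "(A * Z) $$ (p, q) = (\<Sum>s<d. A $$ (p, s) * z $ s) * b $ q / w"
      using pq A by (simp add: Z_def scalar_prod_def lessThan_atLeast0 sum_distrib_right sum_distrib_left sum_divide_distrib mult_ac)
    also have "(\<Sum>s<d. A $$ (p, s) * z $ s) = b $ p"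
      unfolding Az[symmetric] using pq A z by (simp add: scalar_prod_def lessThan_atLeast0)
    finally show "(A * Z) $$ (p, q) = E $$ (p, q)" using pq by (simp add: E_def)
  qed (use A in \<open>auto simp: E_def Z_def\<close>)
  moreover have Zc: "Z \<in> carrier_mat d n" by (simp add: Z_def)
  ultimately have "P' = A * (Y + Z)" unfolding P'_def using A Y(1,2) by (simp add: mult_add_distrib_mat[of _ n d _ n])
  moreover have "(Y + Z) $$ (s, q) = 0" if "s < d" "s \<notin> insert i S" "q < n" for s q
  proof -
    have "(Y *\<^sub>v col A i) $ s = 0" using Y(1) Y(3)[of s] that A by (simp add: scalar_prod_def)
    moreover have "unit_vec d i $ s = (0::real)" using that i by (auto simp: index_unit_vec)
    ultimately show ?thesis using Y(1) Y(3)[of s q] that by (simp add: Z_def z_def)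
  qed
  moreover have "v = 0\<^sub>v d"
    if v: "v \<in> carrier_vec d" "\<And>s. s < d \<Longrightarrow> s \<notin> insert i S \<Longrightarrow> v $ s = 0" "A *\<^sub>v v = 0\<^sub>v n" for v
  proof -
    \<comment> \<open>Linear independence: b is orthogonal to A u, as u is supported on S. Pairing
      the dependency with b therefore leaves v_i w = 0, and the old independence handles the
      rest.\<close>
    define u where "u = vec d (\<lambda>s. if s = i then 0 else v $ s)"
    have u: "u \<in> carrier_vec d" "\<And>s. s < d \<Longrightarrow> s \<notin> S \<Longrightarrow> u $ s = 0" using v(2) by (auto simp: u_def)
    have "v = u + v $ i \<cdot>\<^sub>v unit_vec d i" using v(1) i by (intro eq_vecI) (auto simp: u_def)
    then have "A *\<^sub>v v = A *\<^sub>v u + A *\<^sub>v (v $ i \<cdot>\<^sub>v unit_vec d i)"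
      using A u(1) by (metis mult_add_distrib_mat_vec smult_carrier_vec unit_vec_carrier)
    also have "A *\<^sub>v (v $ i \<cdot>\<^sub>v unit_vec d i) = v $ i \<cdot>\<^sub>v col A i"
      using A i by (simp add: mult_mat_vec mult_mat_unit_vec)
    finally have Av: "A *\<^sub>v u + v $ i \<cdot>\<^sub>v col A i = 0\<^sub>v n" using v(3) by simp
    have Au: "A *\<^sub>v u \<in> carrier_vec n" using A u(1) by simp
    have ci: "col A i \<in> carrier_vec n" using A i by simp
    have bAu: "b \<bullet> (A *\<^sub>v u) = 0"
    proof -
      have "b \<bullet> (A *\<^sub>v u) = col A i \<bullet> ((1\<^sub>m n - P) *\<^sub>v (A *\<^sub>v u))"
        unfolding b_def using transpose_vec_mult_scalar[of "1\<^sub>m n - P" n n "A *\<^sub>v u" "col A i"] residual_carrier P Au ci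
        by (simp add: transpose_minus[of _ n n])
      also have "(1\<^sub>m n - P) *\<^sub>v (A *\<^sub>v u) = A *\<^sub>v u - P *\<^sub>v (A *\<^sub>v u)"
        using P Au by (simp add: minus_mult_distrib_mat_vec[of _ n n])
      finally show ?thesis using projector_fixes[OF u] Au ci by simp
    qed
    have "b \<bullet> (A *\<^sub>v u + v $ i \<cdot>\<^sub>v col A i) = b \<bullet> (A *\<^sub>v u) + v $ i * (b \<bullet> col A i)"
      using b Au ci by (simp add: scalar_prod_add_distrib[of _ n])
    then have "v $ i * w = 0" unfolding Av bAu ba[OF i] w_def[symmetric] using b by simp
    then have "v $ i = 0" using w(1) by simp
    then show "v = 0\<^sub>v d"
      using proj v A unfolding column_projector_def by (metis carrier_matD insert_iff)
  qed
  ultimately have "column_projector A (insert i S) P'"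
    unfolding column_projector_def using A P' P't fix_new fix_old Y(1) Zc
    by (auto intro!: bexI[of _ "Y + Z"])
  moreover have "residual_gram A P' = schur_downdate (residual_gram A P) i"
  proof (rule eq_matI)
    fix p q assume "p < dim_row (schur_downdate (residual_gram A P) i)" "q < dim_col (schur_downdate (residual_gram A P) i)"
    then have pq: "p < d" "q < d" using A by (auto simp: schur_downdate_def residual_gram_def)
    note R' = minus_carrier_mat[OF P', of "1\<^sub>m n"]
    have "residual_gram A P' $$ (p, q) = col A p \<bullet> ((1\<^sub>m n - P') *\<^sub>v col A q)"
    proof -
      have "residual_gram A P' = transpose_mat A * ((1\<^sub>m n - P') * A)"
        using A R' by (simp add: residual_gram_def assoc_mult_mat[of _ d n _ n _ d])
      then show ?thesis using A R' pq by (simp add: col_mult2[of _ n n _ d] del: col_mult)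
    qed
    also have "(1\<^sub>m n - P') *\<^sub>v col A q = (1\<^sub>m n - P) *\<^sub>v col A q - (b \<bullet> col A q / w) \<cdot>\<^sub>v b"
      using A pq P P' b P'v[of "col A q"]
      by (intro eq_vecI) (auto simp: minus_mult_distrib_mat_vec[of _ n n])
    also have "col A p \<bullet> \<dots> = col A p \<bullet> ((1\<^sub>m n - P) *\<^sub>v col A q) - (b \<bullet> col A q / w) * (col A p \<bullet> b)"
      using A pq residual_carrier b by (simp add: scalar_prod_minus_distrib[of _ n])
    finally show "residual_gram A P' $$ (p, q) = schur_downdate (residual_gram A P) i $$ (p, q)"
      using pq A ab[OF pq(1)] ba[OF pq(2)]
      by (simp add: schur_downdate_def residual_gram_index[OF pq, symmetric] w_def residual_gram_def mult.commute)
  qed (use A in \<open>auto simp: schur_downdate_def residual_gram_def\<close>)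
  ultimately show ?thesis using that iS by blast
qed

section \<open>Pseudoinverse and rank of the submatrix of selected columns\<close>

lemma bij_betw_pick: "bij_betw (pick S) {..<card S} S"
proof -
  have "finite S" using S finite_subset by blast
  have "inj_on (pick S) {..<card S}"
    by (intro linorder_inj_onI) (auto dest: pick_mono_le)
  moreover have "pick S ` {..<card S} \<subseteq> S" using pick_in_set_le by auto
  ultimately show ?thesis
    using \<open>finite S\<close> by (simp add: bij_betw_def card_image card_subset_eq)
qed

lemma cols_submat_carrier: "cols_submat A S \<in> carrier_mat n (card S)"
proof -
  have "{j. j < d \<and> j \<in> S} = S" using S by auto
  then show ?thesis using A by (simp add: cols_submat_def submatrix_def)
qed

lemma cols_submat_index:
  assumes "p < n" "j < card S"
  shows "cols_submat A S $$ (p, j) = A $$ (p, pick S j)"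
proof -
  have "{j. j < d \<and> j \<in> S} = S" using S by auto
  then show ?thesis using A assms by (simp add: cols_submat_def submatrix_def pick_UNIV)
qed

text \<open>Vectors on the selected columns are identified with vectors on all columns that vanish off
  \<^term>\<open>S\<close>; the conversion reindexes by \<^const>\<open>pick\<close>.\<close>

lemma cols_submat_mult_vec:
  assumes v: "v \<in> carrier_vec d" "\<And>s. s < d \<Longrightarrow> s \<notin> S \<Longrightarrow> v $ s = 0"
  shows "cols_submat A S *\<^sub>v vec (card S) (\<lambda>j. v $ pick S j) = A *\<^sub>v v"
proof (rule eq_vecI)
  fix p assume "p < dim_vec (A *\<^sub>v v)"
  then have p: "p < n" using A by simp
  have "(cols_submat A S *\<^sub>v vec (card S) (\<lambda>j. v $ pick S j)) $ p = (\<Sum>j<card S. A $$ (p, pick S j) * v $ pick S j)"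
    using p cols_submat_carrier cols_submat_index[OF p] by (simp add: scalar_prod_def lessThan_atLeast0)
  also have "\<dots> = (\<Sum>s\<in>S. A $$ (p, s) * v $ s)"
    by (rule sum.reindex_bij_betw[OF bij_betw_pick])
  also have "\<dots> = (\<Sum>s<d. A $$ (p, s) * v $ s)"
    by (rule sum.mono_neutral_left) (use S v(2) in auto)
  also have "\<dots> = (A *\<^sub>v v) $ p" using p A v(1) by (simp add: scalar_prod_def lessThan_atLeast0)
  finally show "(cols_submat A S *\<^sub>v vec (card S) (\<lambda>j. v $ pick S j)) $ p = (A *\<^sub>v v) $ p" .
qed (use A cols_submat_carrier in auto)

lemma cols_submat_inj:
  assumes v: "v \<in> carrier_vec (card S)" and 0: "cols_submat A S *\<^sub>v v = 0\<^sub>v n"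
  shows "v = 0\<^sub>v (card S)"
proof -
  \<comment> \<open>Extension by zero; counting the smaller elements of S inverts
    \<open>pick\<close>.\<close>
  define u where "u = vec d (\<lambda>s. if s \<in> S then v $ card {a \<in> S. a < s} else 0)"
  have u: "u \<in> carrier_vec d" "\<And>s. s < d \<Longrightarrow> s \<notin> S \<Longrightarrow> u $ s = 0" by (auto simp: u_def)
  have up: "u $ pick S j = v $ j" if "j < card S" for j
    using that pick_in_set_le[OF that] card_pick_le[OF that] S by (auto simp: u_def)
  then have "vec (card S) (\<lambda>j. u $ pick S j) = v" using v by (intro eq_vecI) auto
  then have "A *\<^sub>v u = 0\<^sub>v n" using cols_submat_mult_vec[OF u] 0 by simp
  then have "u = 0\<^sub>v d" using proj A u unfolding column_projector_def by (metis carrier_matD)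
  then have "v $ j = 0" if "j < card S" for j
    using up[OF that] pick_in_set_le[OF that] S by auto
  then show ?thesis using v by (intro eq_vecI) auto
qed

text \<open>The rows of Y indexed by S give an explicit candidate X. From C X = P and X C = I the
  four Penrose conditions follow at once, and uniqueness identifies X with the
  pseudoinverse.\<close>

lemma cols_submat_mult_pinv: "cols_submat A S * pinv (cols_submat A S) = P"
proof -
  define C where "C = cols_submat A S"
  define k where "k = card S"
  have C: "C \<in> carrier_mat n k" using cols_submat_carrier by (simp add: C_def k_def)
  obtain Y where Y: "Y \<in> carrier_mat d n" "P = A * Y" "\<And>s q. s < d \<Longrightarrow> s \<notin> S \<Longrightarrow> q < n \<Longrightarrow> Y $$ (s, q) = 0"
    using projector_factor by blast
  define X where "X = mat k n (\<lambda>(j, q). Y $$ (pick S j, q))"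
  have X: "X \<in> carrier_mat k n" by (simp add: X_def)
  have pick: "pick S j < d" if "j < k" for j using pick_in_set_le[of j S] that S by (auto simp: k_def)
  have CX: "C * X = P"
  proof (rule mat_col_eqI)
    fix q assume "q < dim_col P"
    then have q: "q < n" using projector_carrier by simp
    have "col X q = vec k (\<lambda>j. col Y q $ pick S j)" using q Y(1) pick by (intro eq_vecI) (auto simp: X_def)
    then have "C *\<^sub>v col X q = A *\<^sub>v col Y q"
      unfolding C_def k_def using cols_submat_mult_vec[of "col Y q"] Y q by simp
    then show "col (C * X) q = col P q"
      using C X Y A q by (simp add: col_mult2[of _ n k _ n] col_mult2[of _ n d _ n] del: col_mult)
  qed (use C X projector_carrier in auto)
  have PC: "P * C = C"
  proof (rule mat_col_eqI)
    fix j assume "j < dim_col C"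
    then have j: "j < k" using C by simp
    have "col C j = col A (pick S j)"
      using j C A pick[OF j] cols_submat_index by (intro eq_vecI) (auto simp: C_def k_def)
    moreover have "P *\<^sub>v col A (pick S j) = col A (pick S j)"
      using proj pick_in_set_le[of j S] j by (simp add: column_projector_def k_def)
    ultimately show "col (P * C) j = col C j"
      using C projector_carrier j by (simp add: col_mult2[of _ n n _ k] del: col_mult)
  qed (use C projector_carrier in auto)
  \<comment> \<open>C X C = P C = C, and C is injective, so X C acts as the identity.\<close>
  have XC: "X * C = 1\<^sub>m k"
  proof (rule mat_col_eqI)
    fix j assume "j < dim_col (1\<^sub>m k)"
    then have j: "j < k" by simp
    have "C *\<^sub>v col (X * C) j = col (C * (X * C)) j" using C X j by (simp add: col_mult2[of _ n k _ k] del: col_mult)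
    also have "C * (X * C) = C" using C X CX PC by (metis assoc_mult_mat)
    finally have 1: "C *\<^sub>v col (X * C) j = col C j" .
    have "C *\<^sub>v (col (X * C) j - unit_vec k j) = C *\<^sub>v col (X * C) j - C *\<^sub>v unit_vec k j"
      using C X j by (intro mult_minus_distrib_mat_vec) auto
    also have "\<dots> = 0\<^sub>v n" unfolding 1 using C j by (simp add: mult_mat_unit_vec)
    finally have 0: "C *\<^sub>v (col (X * C) j - unit_vec k j) = 0\<^sub>v n" .
    have "col (X * C) j - unit_vec k j \<in> carrier_vec k" using X C j by (simp add: minus_carrier_vec)
    then have diff: "col (X * C) j - unit_vec k j = 0\<^sub>v k"
      using cols_submat_inj 0 unfolding C_def k_def by blast
    have "col (X * C) j $ p = unit_vec k j $ p" if "p < k" for p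
      using arg_cong[OF diff, of "\<lambda>v. v $ p"] that X C j by simp
    then show "col (X * C) j = col (1\<^sub>m k) j" using X C j by (intro eq_vecI) auto
  qed (use C X in auto)
  have "is_pinv C X"
    unfolding is_pinv_def using C X CX PC XC projector_carrier by simp
  then show ?thesis using pinv_eqI CX by (simp add: C_def)
qed

text \<open>Linear independence is formulated for the set of columns, which would hide a repeated
  column; distinctness is thus established separately for the rank.\<close>

lemma distinct_cols_submat: "distinct (cols (cols_submat A S))"
proof (rule ccontr)
  let ?C = "cols_submat A S"
  note C = cols_submat_carrier
  assume "\<not> ?thesis"
  then obtain i j where ij: "i < card S" "j < card S" "i \<noteq> j" "col ?C i = col ?C j"
    using C by (auto simp: distinct_conv_nth)
  have "?C *\<^sub>v (unit_vec (card S) i - unit_vec (card S) j) = ?C *\<^sub>v unit_vec (card S) i - ?C *\<^sub>v unit_vec (card S) j"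
    using C by (intro mult_minus_distrib_mat_vec) auto
  also have "\<dots> = 0\<^sub>v n" using C ij by (simp add: mult_mat_unit_vec)
  finally have "unit_vec (card S) i - unit_vec (card S) j = (0\<^sub>v (card S) :: real vec)"
    by (intro cols_submat_inj minus_carrier_vec) auto
  from arg_cong[OF this, of "\<lambda>v. v $ i"] show False using ij by simp
qed

lemma rank_cols_submat: "vec_space.rank n (cols_submat A S) = card S"
proof -
  interpret vec_space "TYPE(real)" n .
  show ?thesis
  proof (rule lin_indpt_full_rank[OF cols_submat_carrier distinct_cols_submat])
    show "lin_indpt (set (cols (cols_submat A S)))"
      using lin_depE[OF cols_submat_carrier _ distinct_cols_submat] cols_submat_inj by metis
  qed
qed

text \<open>Diagonal entries are squared residual norms, so every column of A lies in the span of
  the selected ones. Read contrapositively: below full rank a nonzero pivot exists.\<close>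

lemma rank_eq_card_if_residual_zero:
  assumes 0: "\<And>i. i < d \<Longrightarrow> residual_gram A P $$ (i, i) = 0"
  shows "vec_space.rank n A = card S"
proof -
  interpret vec_space "TYPE(real)" n .
  let ?C = "cols_submat A S"
  note C = cols_submat_carrier
  obtain Y where Y: "Y \<in> carrier_mat d n" "P = A * Y" "\<And>s q. s < d \<Longrightarrow> s \<notin> S \<Longrightarrow> q < n \<Longrightarrow> Y $$ (s, q) = 0"
    using projector_factor by blast
  have CA: "set (cols ?C) \<subseteq> set (cols A)"
  proof
    fix x assume "x \<in> set (cols ?C)"
    then obtain j where j: "j < card S" "x = col ?C j" using C by (auto simp: cols_def)
    have "pick S j < d" using pick_in_set_le[OF j(1)] S by auto
    moreover have "x = col A (pick S j)"
      using j C A cols_submat_index \<open>pick S j < d\<close> by (intro eq_vecI) auto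
    ultimately show "x \<in> set (cols A)" using A by (auto simp: cols_def)
  qed
  have "x \<in> span (set (cols ?C))" if xA: "x \<in> set (cols A)" for x
  proof -
    obtain i where i: "i < d" "x = col A i" using xA A by (auto simp: cols_def)
    let ?b = "(1\<^sub>m n - P) *\<^sub>v col A i"
    have bc: "?b \<in> carrier_vec n" using residual_carrier A i(1) by simp
    then have "?b = 0\<^sub>v n"
      using residual_gram_diag[OF i(1)] 0[OF i(1)] conjugate_square_eq_0_vec[of ?b n] by simp
    then have diff: "col A i - P *\<^sub>v col A i = 0\<^sub>v n" using residual_column[OF i(1)] by simp
    have "col A i $ p = (P *\<^sub>v col A i) $ p" if "p < n" for p
      using arg_cong[OF diff, of "\<lambda>v. v $ p"] that A projector_carrier i(1) by simp
    then have "x = P *\<^sub>v col A i" unfolding i(2) using A projector_carrier i(1) by (intro eq_vecI) auto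
    also have "\<dots> = A *\<^sub>v (Y *\<^sub>v col A i)" using A Y(1) i by (simp add: Y(2) assoc_mult_mat_vec[of _ n d _ n])
    also have "\<dots> = ?C *\<^sub>v vec (card S) (\<lambda>j. (Y *\<^sub>v col A i) $ pick S j)"
    proof (rule cols_submat_mult_vec[symmetric])
      show "Y *\<^sub>v col A i \<in> carrier_vec d" using Y(1) A i by simp
      show "(Y *\<^sub>v col A i) $ s = 0" if "s < d" "s \<notin> S" for s
        using that Y(1) Y(3)[of s] A by (simp add: scalar_prod_def)
    qed
    finally have x: "x = ?C *\<^sub>v vec (card S) (\<lambda>j. (Y *\<^sub>v col A i) $ pick S j)" .
    show ?thesis
      unfolding x by (rule in_spanI[OF lincomb_eq_mat_mult[OF C _ distinct_cols_submat, symmetric]]) auto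
  qed
  then have "span (set (cols A)) \<subseteq> span (set (cols ?C))"
    using C by (intro span_subsetI) (auto simp: cols_def)
  moreover have "span (set (cols ?C)) \<subseteq> span (set (cols A))" using CA by (rule span_is_monotone)
  ultimately have "rank A = rank ?C" unfolding rank_def by simp
  then show ?thesis using rank_cols_submat by simp
qed

end

section \<open>Iterated selection\<close>

text \<open>The induction runs over the number of columns still to be added, for arbitrary S and P.
  Nonvanishing of the derivative is proved alongside, because the single step asks for it at every
  admissible pivot.\<close>

lemma exists_columns:
  assumes A: "A \<in> carrier_mat n d"
    and "S \<subseteq> {..<d}" "column_projector A S P" "card S + k \<le> vec_space.rank n A"
  shows "(pderiv ^^ k) (rev_char_poly (residual_gram A P)) \<noteq> 0 \<and>
    (\<exists>S' P'. S' \<subseteq> {..<d} \<and> card S' = card S + k \<and> column_projector A S' P' \<and>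
      roots_below (rev_char_poly (residual_gram A P')) ((pderiv ^^ k) (rev_char_poly (residual_gram A P))))"
  using assms(2-)
proof (induction k arbitrary: S P)
  case 0
  note G = residual_gram_carrier[OF A 0(1,2)]
  have "1\<^sub>m d + 0 \<cdot>\<^sub>m residual_gram A P = 1\<^sub>m d" using G by (intro eq_matI) auto
  then have "poly (rev_char_poly (residual_gram A P)) 0 = 1" by (simp add: poly_rev_char_poly[OF G])
  then have "rev_char_poly (residual_gram A P) \<noteq> 0" by auto
  then show ?case using 0 roots_below_refl by auto
next
  case (Suc k)
  define G where "G = residual_gram A P"
  define B where "B = (1\<^sub>m n - P) * A"
  have B: "B \<in> carrier_mat n d" using A residual_carrier[OF A Suc.prems(1,2)] by (simp add: B_def)
  have G: "G = transpose_mat B * B"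
    using residual_gram_eq[OF A Suc.prems(1,2)] by (simp add: G_def B_def)
  have finS: "finite S" using Suc.prems(1) finite_subset by blast
  have ins: "\<exists>P'. column_projector A (insert i S) P' \<and> i \<notin> S \<and> residual_gram A P' = schur_downdate G i"
    if "i < d" "G $$ (i, i) \<noteq> 0" for i
    using projector_insert[OF A Suc.prems(1,2) that(1)] that(2) unfolding G_def by metis
  \<comment> \<open>The hypothesis is instantiated for every admissible pivot, before one is
    chosen.\<close>
  have IH: "(pderiv ^^ k) (rev_char_poly (schur_downdate G i)) \<noteq> 0 \<and>
      nonneg_coeffs (rev_char_poly (schur_downdate G i)) \<and>
      (\<exists>S' P'. S' \<subseteq> {..<d} \<and> card S' = card S + Suc k \<and> column_projector A S' P' \<and>
      roots_below (rev_char_poly (residual_gram A P')) ((pderiv ^^ k) (rev_char_poly (schur_downdate G i))))"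
    if i: "i < d" "G $$ (i, i) \<noteq> 0" for i
  proof -
    obtain P' where P': "column_projector A (insert i S) P'" "i \<notin> S" "residual_gram A P' = schur_downdate G i"
      using ins[OF i] by blast
    have sub: "insert i S \<subseteq> {..<d}" using Suc.prems(1) i by simp
    have "card (insert i S) = Suc (card S)" using P'(2) finS by simp
    then show ?thesis
      using Suc.IH[OF sub P'(1)] Suc.prems(3)
        nonneg_coeffs_rev_char_poly[OF _ residual_gram_eq[OF A sub P'(1)], of n d]
        A residual_carrier[OF A sub P'(1)] P'(3) by simp
  qed
  have ex: "\<exists>i<d. G $$ (i, i) \<noteq> 0"
  proof (rule ccontr)
    assume "\<not> ?thesis"
    then have "vec_space.rank n A = card S"
      using rank_eq_card_if_residual_zero[OF A Suc.prems(1,2)] by (auto simp: G_def)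
    then show False using Suc.prems(3) by simp
  qed
  have step: "(pderiv ^^ Suc k) (rev_char_poly G) \<noteq> 0"
    "\<exists>i<d. G $$ (i, i) \<noteq> 0 \<and>
      roots_below ((pderiv ^^ k) (rev_char_poly (schur_downdate G i))) ((pderiv ^^ Suc k) (rev_char_poly G))"
    using schur_downdate_step[OF B G, of k] IH ex by blast+
  then obtain i where i: "i < d" "G $$ (i, i) \<noteq> 0"
    and below: "roots_below ((pderiv ^^ k) (rev_char_poly (schur_downdate G i))) ((pderiv ^^ Suc k) (rev_char_poly G))"
    by blast
  show ?case using step(1) IH[OF i] roots_below_trans[OF _ below] unfolding G_def by blast
qed

text \<open>For p(x) = x^d Q(-1/x) one has x^2 p' = d x p + x^d Q'(-1/x), and the term -d x p of the
  operator removes the first part. The identity is differentiated as one of real functions near x,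
  away from 0.\<close>

lemma poly_polar_op_funpow:
  assumes p: "\<And>x. x \<noteq> 0 \<Longrightarrow> poly p x = x ^ d * poly R (- 1 / x)" and "x \<noteq> 0"
  shows "poly ((polar_op d ^^ k) p) x = x ^ d * poly ((pderiv ^^ k) R) (- 1 / x)"
  using assms(2)
proof (induction k arbitrary: x)
  case 0
  then show ?case using p by simp
next
  case (Suc k)
  define q where "q = (polar_op d ^^ k) p"
  define Q where "Q = (pderiv ^^ k) R"
  have q: "poly q x = x ^ d * poly Q (- 1 / x)" if "x \<noteq> 0" for x using Suc.IH[OF that] by (simp add: q_def Q_def)
  have inv: "((\<lambda>x. - 1 / x) has_real_derivative 1 / x\<^sup>2) (at x)"
    using Suc.prems by (auto intro!: derivative_eq_intros simp: power2_eq_square)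
  have "((\<lambda>x. x ^ d * poly Q (- 1 / x)) has_real_derivative
      real d * x ^ (d - 1) * poly Q (- 1 / x) + poly (pderiv Q) (- 1 / x) * (1 / x\<^sup>2) * x ^ d) (at x)"
    using DERIV_mult[OF DERIV_pow[of d x] DERIV_chain2[OF poly_DERIV inv]] by simp
  moreover have "eventually (\<lambda>x. poly q x = x ^ d * poly Q (- 1 / x)) (nhds x)"
    using q Suc.prems by (auto intro: eventually_mono[OF t1_space_nhds])
  ultimately have "(poly q has_real_derivative
      real d * x ^ (d - 1) * poly Q (- 1 / x) + poly (pderiv Q) (- 1 / x) * (1 / x\<^sup>2) * x ^ d) (at x)"
    by (subst DERIV_cong_ev[OF refl _ refl])
  then have q': "poly (pderiv q) x = real d * x ^ (d - 1) * poly Q (- 1 / x) + poly (pderiv Q) (- 1 / x) * (1 / x\<^sup>2) * x ^ d"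
    using DERIV_unique poly_DERIV by blast
  \<comment> \<open>At d = 0 the truncated exponent is harmless because of the factor
    \<open>real d\<close>.\<close>
  have "x\<^sup>2 * (real d * x ^ (d - 1)) = real d * x * x ^ d"
    by (cases d) (auto simp: power2_eq_square)
  then have "x\<^sup>2 * poly (pderiv q) x = real d * x * x ^ d * poly Q (- 1 / x) + x ^ d * poly (pderiv Q) (- 1 / x)"
    unfolding q' using Suc.prems by (simp add: distrib_left mult.assoc[symmetric])
  then have "poly (polar_op d q) x = x ^ d * poly (pderiv Q) (- 1 / x)"
    using q[OF Suc.prems] by (simp add: polar_op_def power2_eq_square algebra_simps)
  then show ?case by (simp add: q_def Q_def)
qed

theorem theorem1p3:
  fixes A :: "real mat" and n d k :: nat
  assumes "A \<in> carrier_mat n d"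
    and "0 < k"
    and "k \<le> vec_space.rank n A"
  shows "\<exists>S. S \<subseteq> {0..<d} \<and> card S = k \<and>
    vec_space.rank n (cols_submat A S) = k \<and>
    maxroot (char_poly (transpose_mat A *
        (1\<^sub>m n - cols_submat A S * pinv (cols_submat A S)) * A))
      \<le> maxroot ((polar_op d ^^ k) (char_poly (transpose_mat A * A)))"
proof -
  note A = assms(1)
  have proj0: "column_projector A {} (0\<^sub>m n n)"
    unfolding column_projector_def using A by (auto intro!: bexI[of _ "0\<^sub>m d n"] eq_vecI)
  have "1\<^sub>m n - 0\<^sub>m n n = (1\<^sub>m n :: real mat)" by (rule eq_matI) auto
  then have gram0: "residual_gram A (0\<^sub>m n n) = transpose_mat A * A" using A by (simp add: residual_gram_def)
  define G where "G = transpose_mat A * A"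
  define R where "R = rev_char_poly G"
  define D where "D = (polar_op d ^^ k) (char_poly G)"
  have G: "G \<in> carrier_mat d d" using A by (simp add: G_def)
  obtain S P where Rk: "(pderiv ^^ k) R \<noteq> 0" and S: "S \<subseteq> {..<d}" "card S = k" "column_projector A S P"
    and below: "roots_below (rev_char_poly (residual_gram A P)) ((pderiv ^^ k) R)"
    using exists_columns[OF A _ proj0, of k] assms(3) by (auto simp: gram0 R_def G_def)
  define H where "H = residual_gram A P"
  have H: "H \<in> carrier_mat d d" using residual_gram_carrier[OF A S(1,3)] by (simp add: H_def)
  have Dx: "poly D x = x ^ d * poly ((pderiv ^^ k) R) (- 1 / x)" if "x \<noteq> 0" for x
    unfolding D_def R_def by (rule poly_polar_op_funpow[OF char_poly_eq_rev_char_poly[OF G] that])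
  have "D \<noteq> 0"
  proof
    assume "D = 0"
    then have "poly ((pderiv ^^ k) R) y = 0" if "0 < y" for y
      using Dx[of "- 1 / y"] that by simp
    then have "{0<..} \<subseteq> {y. poly ((pderiv ^^ k) R) y = 0}" by auto
    then show False using poly_roots_finite[OF Rk] infinite_Ioi[of "0::real"] finite_subset by blast
  qed
  then have finD: "finite {x. poly D x = 0}" by (rule poly_roots_finite)
  \<comment> \<open>Both terms of the operator carry a factor x and k > 0, so 0 is a root. Hence
    \<open>maxroot D\<close> is nonnegative, which settles all nonpositive roots on the left
    side.\<close>
  have D0: "poly D 0 = 0"
    using \<open>0 < k\<close> by (cases k) (simp_all add: D_def polar_op_def)
  have pos: "0 \<le> maxroot D" unfolding maxroot_def using finD D0 by (intro Max_ge) auto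
  \<comment> \<open>A positive root x corresponds to -1/x, which lies below some root y of the
    differentiated polynomial. That y is negative, so -1/y is a root of \<open>D\<close>, and it is
    at least x by monotonicity.\<close>
  have root_le: "x \<le> maxroot D" if "poly (char_poly H) x = 0" for x
  proof (cases "x \<le> 0")
    case False
    then have "poly (rev_char_poly H) (- 1 / x) = 0"
      using that char_poly_eq_rev_char_poly[OF H, of x] by simp
    then obtain y where y: "- 1 / x \<le> y" "poly ((pderiv ^^ k) R) y = 0"
      using below unfolding roots_below_def H_def by blast
    have "y < 0"
    proof (rule ccontr)
      assume "\<not> y < 0"
      moreover have "y \<noteq> 0"
        using y(2) Rk poly_0_pderiv_funpow_rev_char_poly[OF A refl] by (auto simp: R_def G_def)
      moreover have "nonneg_coeffs ((pderiv ^^ k) R)"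
        unfolding R_def G_def by (intro nonneg_coeffs_pderiv_funpow nonneg_coeffs_rev_char_poly[OF A refl])
      ultimately show False using nonneg_coeffs_poly_pos[OF _ Rk, of y] y(2) by simp
    qed
    then have "poly D (- 1 / y) = 0" using Dx[of "- 1 / y"] y(2) by simp
    then have "- 1 / y \<le> maxroot D" unfolding maxroot_def using finD by (intro Max_ge) auto
    moreover have "x \<le> - 1 / y" using y(1) False \<open>y < 0\<close> by (simp add: field_simps)
    ultimately show ?thesis by simp
  qed (use pos in simp)
  have "char_poly H \<noteq> 0" using degree_monic_char_poly[OF H] by auto
  then have finH: "finite {x. poly (char_poly H) x = 0}" by (rule poly_roots_finite)
  have "0 < d" using S \<open>0 < k\<close> by (cases d) auto
  \<comment> \<open>Symmetry supplies a real root, so the maximum on the left side is taken over a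
    nonempty set.\<close>
  have "H = transpose_mat H"
    using residual_gram_sym[OF A S(1,3)] H by (intro eq_matI) (auto simp: H_def)
  then obtain x where "poly (char_poly H) x = 0"
  proof -
    obtain l v where v: "v \<in> carrier_vec d" "v \<bullet> v = 1" "H *\<^sub>v v = l \<cdot>\<^sub>v v"
      using symmetric_mat_unit_eigenvector[OF H _ \<open>0 < d\<close>] \<open>H = transpose_mat H\<close> by metis
    then have "v \<noteq> 0\<^sub>v d" by auto
    with v have "eigenvalue H l" using H by (auto simp: eigenvalue_def eigenvector_def)
    then show ?thesis using that eigenvalue_root_char_poly[OF H] by blast
  qed
  then have "maxroot (char_poly H) \<le> maxroot D"
    unfolding maxroot_def[of "char_poly H"] using finH root_le by (subst Max_le_iff) auto
  moreover have "H = transpose_mat A * (1\<^sub>m n - cols_submat A S * pinv (cols_submat A S)) * A"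
    unfolding cols_submat_mult_pinv[OF A S(1,3)] H_def residual_gram_def using A by simp
  ultimately show ?thesis
    using S rank_cols_submat[OF A S(1,3)] by (auto simp: D_def G_def lessThan_atLeast0 intro!: exI[of _ S])
qed

end
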